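(* Let $(x_n)_{n=1}^{\infty}$ be a sequence in $[0,1]$ defined greedily such that for every $N \geq 2$ the element $x_N$ satisfies $$ \sum_{n=1}^{N-1} \sum_{k=1}^{N} \frac{\cos\left(2 \pi k (x_N-x_n)\right)}{k} \leq 0.$$ Then there is a constant $C>0$ such that for all $N \geq 2$, $$ D_N^* \leq C\,\frac{\log N}{\sqrt{N}}.$$
   Context: For a sequence $(x_n)_{n=1}^{\infty}$ in $[0,1]$, the star discrepancy of its first $N$ elements is $$ D_N^* = \sup_{0 \leq x \leq 1} \left| \frac{\#\{1 \leq i \leq N : x_i \leq x\}}{N} - x \right|.$$ *)

theory Defs
  imports Complex_Main
begin

text \<open>
  Sequences are functions \<open>nat \<Rightarrow> real\<close> of which only the values at indices \<open>n \<ge> 1\<close> are used.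
\<close>

definition star_discrepancy :: "(nat \<Rightarrow> real) \<Rightarrow> nat \<Rightarrow> real" where
  "star_discrepancy x N =
     (SUP t\<in>{0..1}. \<bar>real (card {i \<in> {1..N}. x i \<le> t}) / real N - t\<bar>)"

end

theory Submission
  imports Defs "HOL-Analysis.Analysis"
begin

text \<open>
  The truncated logarithmic kernel \<open>g N \<theta> = (\<Sum>k = 1..N. cos (k \<theta>) / k)\<close> changes with \<open>N\<close>, and the
  sharp cutoff would make the energy \<open>\<Sum>k = 1..N. |S N k|\<^sup>2 / k\<close> of the exponential sums \<open>S N k\<close> jump
  uncontrollably when the cutoff moves. It is therefore replaced by a positive definite minorant.
  Writing \<open>1 / k\<close> as the integral of \<open>(1 - \<rho>) ^ (k - 1)\<close> over \<open>[0, 1]\<close> and inserting the weight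
  \<open>sqrt (\<rho> / (\<rho> + c / N))\<close> produces coefficients \<open>a N k\<close> such that
  \<open>(\<Sum>k. a N k * cos (k \<theta>)) \<le> g N \<theta> + O(ln N / N)\<close> uniformly in \<open>\<theta>\<close>: the Poisson kernels weighted by one
  minus that weight absorb the oscillating tail of \<open>g N\<close>. The square root makes \<open>a N k\<close> grow in \<open>N\<close> only by
  the factor \<open>sqrt (N / (N - 1))\<close> per step, so the greedy condition gives
  \<open>E N \<le> sqrt (N / (N - 1)) * E (N - 1) + O(ln N)\<close> for \<open>E N = (\<Sum>k. a N k * |S N k|\<^sup>2)\<close>, that is,
  \<open>E N = O(N * ln N)\<close>.

  Since \<open>a N k\<close> is at least a constant times \<open>(1 - 1 / N) ^ k / k\<close>, the discrepancy estimate follows from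
  the Cauchy--Schwarz inequality and an approximation of the sawtooth by geometrically damped sine
  series whose error is dominated by a single Poisson kernel.
\<close>

section \<open>A positive definite minorant of the truncated logarithmic kernel\<close>

text \<open>The squared modulus of 1 - r exp(i \<theta>), for real r.\<close>

definition poisson_den :: "real \<Rightarrow> real \<Rightarrow> real" where
  "poisson_den r \<theta> = 1 - 2 * r * cos \<theta> + r\<^sup>2"

lemma cos_eq_sin_half: "cos \<theta> = 1 - 2 * (sin (\<theta> / 2))\<^sup>2" for \<theta> :: real
  using cos_double_sin[of "\<theta> / 2"] by simp

lemma poisson_den_half_angle:
  "poisson_den (1 - \<rho>) \<theta> = \<rho>\<^sup>2 + 4 * (1 - \<rho>) * (sin (\<theta> / 2))\<^sup>2"
  unfolding poisson_den_def cos_eq_sin_half[of \<theta>] by (simp add: power2_eq_square algebra_simps)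

lemma sin_sq_le_1: "(sin x)\<^sup>2 \<le> 1" for x :: real
  by (simp add: abs_square_le_1)

text \<open>This bound does not depend on \<rho>, so it can replace the denominator in error terms
  before integrating over \<rho>.\<close>

lemma poisson_den_ge_sin:
  assumes "0 \<le> \<rho>" "\<rho> \<le> 1"
  shows "(sin (\<theta> / 2))\<^sup>2 \<le> poisson_den (1 - \<rho>) \<theta>"
proof -
  define q where "q = (sin (\<theta> / 2))\<^sup>2"
  have q: "0 \<le> q" "q \<le> 1" unfolding q_def by (simp_all add: sin_sq_le_1)
  have "\<rho>\<^sup>2 + 4 * (1 - \<rho>) * q - q = \<rho>\<^sup>2 * (1 - q) + (1 - \<rho>) * (3 - \<rho>) * q"
    by (simp add: power2_eq_square algebra_simps)
  also have "\<dots> \<ge> 0" using q assms by (intro add_nonneg_nonneg mult_nonneg_nonneg) auto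
  finally show ?thesis by (simp add: poisson_den_half_angle q_def)
qed

lemma poisson_den_le_sin:
  assumes "0 \<le> \<rho>"
  shows "poisson_den (1 - \<rho>) \<theta> \<le> \<rho>\<^sup>2 + 4 * (sin (\<theta> / 2))\<^sup>2"
  unfolding poisson_den_half_angle using assms by (simp add: algebra_simps)

lemma poisson_den_ge_gap: "0 \<le> r \<Longrightarrow> (1 - r)\<^sup>2 \<le> poisson_den r \<theta>"
proof -
  assume "0 \<le> r"
  then have "r * cos \<theta> \<le> r" by (simp add: mult_left_le)
  then show ?thesis unfolding poisson_den_def by (simp add: power2_eq_square algebra_simps)
qed

text \<open>Real part of the geometric sum of r^k exp(i (k + 1) \<theta>), cleared of its
  denominator; the induction runs on the Chebyshev recurrence for cos.\<close>

lemma cos_power_sum: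
  "poisson_den r \<theta> * (\<Sum>k<M. r ^ k * cos (real (Suc k) * \<theta>))
    = cos \<theta> - r - r ^ M * (cos (real (Suc M) * \<theta>) - r * cos (real M * \<theta>))"
proof (induction M)
  case 0
  then show ?case by simp
next
  case (Suc M)
  have A: "cos (real (Suc (Suc M)) * \<theta>) = 2 * cos \<theta> * cos (real (Suc M) * \<theta>) - cos (real M * \<theta>)"
  proof -
    have "real (Suc (Suc M)) * \<theta> = real (Suc M) * \<theta> + \<theta>" "real M * \<theta> = real (Suc M) * \<theta> - \<theta>"
      by (simp_all add: algebra_simps)
    then show ?thesis by (simp only: cos_add cos_diff) simp
  qed
  show ?case
    unfolding sum.lessThan_Suc distrib_left Suc.IH A
    by (simp add: poisson_den_def power2_eq_square algebra_simps)
qed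

text \<open>The left side is the real part of exp(i M \<theta>) (exp(i \<theta>) - r) in absolute
  value, and the squared modulus of exp(i \<theta>) - r is
  \<open>poisson_den r \<theta>\<close>.\<close>

lemma cos_remainder_bound:
  "\<bar>cos (real (Suc M) * \<theta>) - r * cos (real M * \<theta>)\<bar> \<le> sqrt (poisson_den r \<theta>)"
proof -
  define a where "a = real M * \<theta>"
  have e: "cos (real (Suc M) * \<theta>) - r * cos (real M * \<theta>)
      = cos a * (cos \<theta> - r) - sin a * sin \<theta>"
    unfolding a_def by (simp add: distrib_right cos_add algebra_simps)
  have D: "poisson_den r \<theta> = (cos \<theta> - r)\<^sup>2 + (sin \<theta>)\<^sup>2"
    unfolding poisson_den_def using sin_cos_squared_add[of \<theta>]
    by (simp add: power2_eq_square algebra_simps)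
  have "(cos a * (cos \<theta> - r) - sin a * sin \<theta>)\<^sup>2 + (sin a * (cos \<theta> - r) + cos a * sin \<theta>)\<^sup>2
      = ((cos a)\<^sup>2 + (sin a)\<^sup>2) * ((cos \<theta> - r)\<^sup>2 + (sin \<theta>)\<^sup>2)"
    by algebra
  then have "(cos a * (cos \<theta> - r) - sin a * sin \<theta>)\<^sup>2 \<le> poisson_den r \<theta>"
    unfolding D by (simp add: add_increasing2) (smt (verit) zero_le_power2)
  then show ?thesis
    unfolding e by (intro real_le_rsqrt) simp
qed

text \<open>For r < 1 the quotient is the sum of the infinite series. The estimate comes from the
  closed form and so covers r = 1 too, the endpoint \<rho> = 0 of the later integrals.\<close>

lemma cos_power_sum_approx:
  assumes "0 \<le> r" "0 < poisson_den r \<theta>"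
  shows "\<bar>(\<Sum>k<M. r ^ k * cos (real (Suc k) * \<theta>)) - (cos \<theta> - r) / poisson_den r \<theta>\<bar>
    \<le> r ^ M / sqrt (poisson_den r \<theta>)"
proof -
  define D where "D = poisson_den r \<theta>"
  define R where "R = cos (real (Suc M) * \<theta>) - r * cos (real M * \<theta>)"
  have D: "0 < D" "sqrt D * sqrt D = D" using assms by (auto simp: D_def)
  have "(\<Sum>k<M. r ^ k * cos (real (Suc k) * \<theta>)) - (cos \<theta> - r) / D = - (r ^ M * R / D)"
  proof -
    have "(\<Sum>k<M. r ^ k * cos (real (Suc k) * \<theta>)) = (cos \<theta> - r - r ^ M * R) / D"
      using cos_power_sum[of r \<theta> M] D unfolding D_def[symmetric] R_def[symmetric]
      by (metis less_irrefl nonzero_mult_div_cancel_left)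
    then show ?thesis by (simp add: diff_divide_distrib)
  qed
  then have "\<bar>(\<Sum>k<M. r ^ k * cos (real (Suc k) * \<theta>)) - (cos \<theta> - r) / D\<bar> = r ^ M * \<bar>R\<bar> / D"
    using D assms by (simp add: abs_mult)
  also have "\<dots> \<le> r ^ M * sqrt D / D"
    using cos_remainder_bound[of M \<theta> r] D assms
    unfolding R_def[symmetric] D_def[symmetric] by (intro divide_right_mono mult_left_mono) auto
  also have "\<dots> = r ^ M / sqrt D" using D by (simp add: field_simps)
  finally show ?thesis by (simp add: D_def)
qed

text \<open>Multiplied by r, the right side is (P - 1) / 2 with P the Poisson kernel. The constant
  3/2 absorbs the missing factor r, so that no division by r is needed, and leaves a non-negative
  main term.\<close>

lemma conjugate_kernel_ge:
  assumes "0 \<le> r" "r \<le> 1" "0 < poisson_den r \<theta>"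
  shows "(1 - r\<^sup>2) / (2 * poisson_den r \<theta>) - 3 / 2 \<le> (cos \<theta> - r) / poisson_den r \<theta>"
proof -
  have c: "-1 \<le> cos \<theta>" "cos \<theta> \<le> 1" by simp_all
  have "0 \<le> 2 * ((1 + cos \<theta>) * (1 - r)\<^sup>2 + (1 - cos \<theta>) * (r + r\<^sup>2))"
  proof -
    have "0 \<le> 1 + cos \<theta>" "0 \<le> 1 - cos \<theta>" using c by linarith+
    then have "0 \<le> (1 + cos \<theta>) * (1 - r)\<^sup>2" "0 \<le> (1 - cos \<theta>) * (r + r\<^sup>2)"
      using assms by simp_all
    then show ?thesis by (intro mult_nonneg_nonneg[of 2] add_nonneg_nonneg) simp_all
  qed
  also have "\<dots> = 2 * (cos \<theta> - r) - (1 - r\<^sup>2) + 3 * poisson_den r \<theta>"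
    unfolding poisson_den_def by (simp add: power2_eq_square algebra_simps)
  finally have "0 \<le> (2 * (cos \<theta> - r) - (1 - r\<^sup>2) + 3 * poisson_den r \<theta>) / (2 * poisson_den r \<theta>)"
    using assms by simp
  also have "\<dots> = (cos \<theta> - r) / poisson_den r \<theta> - ((1 - r\<^sup>2) / (2 * poisson_den r \<theta>) - 3 / 2)"
    using assms by (simp add: add_divide_distrib diff_divide_distrib)
  finally show ?thesis by simp
qed

section \<open>The damping weight and the coefficients of the minorant\<close>

definition damp :: "real \<Rightarrow> real \<Rightarrow> real" where
  "damp e \<rho> = sqrt (\<rho> / (\<rho> + e))"

text \<open>\<open>coef e k\<close> belongs to the frequency \<open>k + 1\<close>; without the factor \<open>damp\<close> it would be \<open>1 / (k + 1)\<close>.\<close>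

definition coef :: "real \<Rightarrow> nat \<Rightarrow> real" where
  "coef e k = integral {0..1} (\<lambda>\<rho>. damp e \<rho> * (1 - \<rho>) ^ k)"

lemma continuous_on_damp [continuous_intros]:
  assumes "0 < e" shows "continuous_on {0..1} (damp e)"
  unfolding damp_def using assms by (intro continuous_intros) auto

text \<open>With v = e / (\<rho> + e) the weight is sqrt (1 - v), which lies between 1 - v and 1 - v
  / 2. The lower bound for \<open>1 - damp e \<rho>\<close> yields the gain of the minorant, the
  upper bound limits its loss.\<close>

lemma damp_bounds:
  assumes "0 < e" "0 \<le> \<rho>"
  shows "0 \<le> damp e \<rho>" "damp e \<rho> \<le> 1"
    "e / (\<rho> + e) / 2 \<le> 1 - damp e \<rho>" "1 - damp e \<rho> \<le> e / (\<rho> + e)"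
proof -
  define v where "v = e / (\<rho> + e)"
  have v: "0 \<le> v" "v \<le> 1" "\<rho> / (\<rho> + e) = 1 - v" using assms by (auto simp: v_def field_simps)
  have d: "damp e \<rho> = sqrt (1 - v)" using v by (simp add: damp_def)
  show "0 \<le> damp e \<rho>" "damp e \<rho> \<le> 1" using v by (auto simp: d)
  have "sqrt (1 - v) \<le> 1 - v / 2"
    using v by (intro real_le_lsqrt) (auto simp: power2_eq_square algebra_simps)
  then show "e / (\<rho> + e) / 2 \<le> 1 - damp e \<rho>" by (simp add: d v_def)
  have "1 - v \<le> sqrt (1 - v)"
    using v by (intro real_le_rsqrt) (auto simp: power2_eq_square mult_left_le)
  then show "1 - damp e \<rho> \<le> e / (\<rho> + e)" by (simp add: d v_def)
qed

lemma has_integral_power_one_minus: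
  "a \<le> 1 \<Longrightarrow> ((\<lambda>\<rho>::real. (1 - \<rho>) ^ k) has_integral ((1 - a) ^ Suc k / real (Suc k))) {a..1}"
proof -
  assume a: "a \<le> 1"
  have "((\<lambda>\<rho>::real. (1 - \<rho>) ^ k) has_integral
      ((- ((1 - 1) ^ Suc k / real (Suc k))) - (- ((1 - a) ^ Suc k / real (Suc k))))) {a..1}"
  proof (rule fundamental_theorem_of_calculus[OF a])
    fix x :: real
    show "((\<lambda>x. - ((1 - x) ^ Suc k / real (Suc k))) has_vector_derivative (1 - x) ^ k) (at x within {a..1})"
      unfolding has_real_derivative_iff_has_vector_derivative[symmetric]
      by (rule derivative_eq_intros refl | simp)+
  qed
  then show ?thesis by simp
qed

lemma coef_integrable:
  "0 < e \<Longrightarrow> (\<lambda>\<rho>. damp e \<rho> * (1 - \<rho>) ^ k) integrable_on {0..1}"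
  by (intro integrable_continuous_real continuous_intros)

lemma coef_nonneg: "0 < e \<Longrightarrow> 0 \<le> coef e k"
  unfolding coef_def
  by (intro integral_nonneg coef_integrable) (auto simp: damp_bounds)

text \<open>The quotients under the two roots differ at every \<rho> by a factor of at most e' / e,
  and the root halves the exponent. With e = c / (N + 1) and e' = c / N this is the growth factor of
  one greedy step.\<close>

lemma coef_scale:
  assumes "0 < e" "e \<le> e'"
  shows "coef e k \<le> sqrt (e' / e) * coef e' k"
proof -
  have "coef e k \<le> integral {0..1} (\<lambda>\<rho>. sqrt (e' / e) * (damp e' \<rho> * (1 - \<rho>) ^ k))"
    unfolding coef_def
  proof (rule integral_le)
    show "(\<lambda>\<rho>. damp e \<rho> * (1 - \<rho>) ^ k) integrable_on {0..1}" using assms by (simp add: coef_integrable)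
    show "(\<lambda>\<rho>. sqrt (e' / e) * (damp e' \<rho> * (1 - \<rho>) ^ k)) integrable_on {0..1}"
      using coef_integrable[of e' k] assms by (intro integrable_on_mult_right) auto
    fix \<rho> :: real assume r: "\<rho> \<in> {0..1}"
    have "\<rho> / (\<rho> + e) \<le> e' / e * (\<rho> / (\<rho> + e'))"
    proof -
      have "\<rho> * (e * (\<rho> + e')) \<le> \<rho> * (e' * (\<rho> + e))"
        using assms r by (intro mult_left_mono) (auto simp: algebra_simps mult_right_mono mult_left_mono)
      then show ?thesis using assms r by (simp add: divide_simps) (simp add: algebra_simps add_nonneg_eq_0_iff)
    qed
    then have "damp e \<rho> \<le> sqrt (e' / e) * damp e' \<rho>"
      unfolding damp_def real_sqrt_mult[symmetric] by (rule real_sqrt_le_mono)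
    then show "damp e \<rho> * (1 - \<rho>) ^ k \<le> sqrt (e' / e) * (damp e' \<rho> * (1 - \<rho>) ^ k)"
      using r by (simp add: mult_right_mono flip: mult.assoc)
  qed
  then show ?thesis by (simp add: coef_def)
qed

text \<open>On {a..1} the weight is at least sqrt (1 / (1 + c)), and that part of the integral
  already gives the power on the left.\<close>

lemma coef_ge:
  assumes "0 < c" "0 < a" "a \<le> 1"
  shows "sqrt (1 / (1 + c)) * ((1 - a) ^ Suc k / real (Suc k)) \<le> coef (c * a) k"
proof -
  have ca: "0 < c * a" using assms by simp
  have "((\<lambda>\<rho>. sqrt (1 / (1 + c)) * (1 - \<rho>) ^ k) has_integral
       sqrt (1 / (1 + c)) * ((1 - a) ^ Suc k / real (Suc k))) {a..1}"
    using assms by (intro has_integral_mult_right has_integral_power_one_minus)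
  moreover have i: "(\<lambda>\<rho>. damp (c * a) \<rho> * (1 - \<rho>) ^ k) integrable_on {a..1}"
    using coef_integrable[OF ca, of k] by (rule integrable_on_subinterval) (use assms in auto)
  ultimately have "sqrt (1 / (1 + c)) * ((1 - a) ^ Suc k / real (Suc k))
      \<le> integral {a..1} (\<lambda>\<rho>. damp (c * a) \<rho> * (1 - \<rho>) ^ k)"
  proof (rule has_integral_le[OF _ integrable_integral])
    fix \<rho> assume r: "\<rho> \<in> {a..1}"
    have "1 / (1 + c) \<le> \<rho> / (\<rho> + c * a)"
    proof -
      have "c * a \<le> c * \<rho>" using r assms by simp
      then have "\<rho> + c * a \<le> \<rho> * (1 + c)" by (simp add: algebra_simps)
      then show ?thesis using assms r ca by (simp add: divide_simps) (smt (verit) mult_pos_pos)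
    qed
    then show "sqrt (1 / (1 + c)) * (1 - \<rho>) ^ k \<le> damp (c * a) \<rho> * (1 - \<rho>) ^ k"
      unfolding damp_def using r by (intro mult_right_mono real_sqrt_le_mono) auto
  qed
  also have "\<dots> \<le> coef (c * a) k"
    unfolding coef_def
    by (rule integral_subset_le) (use assms ca i coef_integrable[OF ca, of k] damp_bounds[OF ca] in auto)
  finally show ?thesis .
qed

text \<open>Bounds the minorant at the origin, uniformly in M: the geometric sum is at most 1 /
  \<rho>, and \<open>damp e \<rho> / \<rho>\<close> stays integrable at 0 with integral at most 3 -
  ln e.\<close>

lemma sum_coef_le:
  assumes "0 < e" "e \<le> 1"
  shows "(\<Sum>k<M. coef e k) \<le> 3 - ln e"
proof -
  \<comment> \<open>an antiderivative of \<open>damp e \<rho> / \<rho>\<close>, which dominates the damped geometric sums\<close>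
  define F where "F \<rho> = 2 * ln (sqrt \<rho> + sqrt (\<rho> + e))" for \<rho>
  have iF: "((\<lambda>\<rho>. 1 / (sqrt \<rho> * sqrt (\<rho> + e))) has_integral (F 1 - F 0)) {0..1}"
  proof (rule fundamental_theorem_of_calculus_interior)
    have "sqrt \<rho> + sqrt (\<rho> + e) \<noteq> 0" if "\<rho> \<in> {0..1}" for \<rho>
      using that assms by (smt (verit) atLeastAtMost_iff real_sqrt_ge_zero real_sqrt_gt_zero)
    then show "continuous_on {0..1} F" unfolding F_def by (intro continuous_intros) auto
    fix x :: real assume "x \<in> {0<..<1}"
    then have x: "0 < x" by simp
    define s t where "s = sqrt x" "t = sqrt (x + e)"
    have st: "0 < s" "0 < t" using x assms by (auto simp: s_t_def)
    have "(F has_real_derivative 2 * ((inverse s / 2 + inverse t / 2) / (s + t))) (at x)"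
      unfolding F_def s_t_def using x assms st[unfolded s_t_def]
      by (auto intro!: derivative_eq_intros simp: add_pos_pos)
    moreover have "2 * ((inverse s / 2 + inverse t / 2) / (s + t)) = 1 / (s * t)"
    proof -
      have "inverse s / 2 + inverse t / 2 = (s + t) / (2 * (s * t))" using st by (simp add: field_simps)
      then show ?thesis using st by simp
    qed
    ultimately show "(F has_vector_derivative 1 / (sqrt x * sqrt (x + e))) (at x)"
      unfolding has_real_derivative_iff_has_vector_derivative[symmetric] s_t_def by simp
  qed simp
  have iS: "((\<lambda>\<rho>. \<Sum>k<M. damp e \<rho> * (1 - \<rho>) ^ k) has_integral (\<Sum>k<M. coef e k)) {0..1}"
    unfolding coef_def using assms by (intro has_integral_sum) (auto intro: integrable_integral coef_integrable)
  have "(\<Sum>k<M. coef e k) \<le> F 1 - F 0"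
  proof (rule has_integral_le[OF iS iF])
    fix \<rho> :: real assume r: "\<rho> \<in> {0..1}"
    show "(\<Sum>k<M. damp e \<rho> * (1 - \<rho>) ^ k) \<le> 1 / (sqrt \<rho> * sqrt (\<rho> + e))"
    proof (cases "\<rho> = 0")
      \<comment> \<open>Both sides are 0: the weight vanishes at 0, and so does division by
        0.\<close>
      case True then show ?thesis by (simp add: damp_def)
    next
      case False
      with r have p: "0 < \<rho>" "\<rho> \<le> 1" by auto
      have "(\<Sum>k<M. (1 - \<rho>) ^ k) = (1 - (1 - \<rho>) ^ M) / \<rho>"
        using p by (simp add: sum_gp_strict)
      also have "\<dots> \<le> 1 / \<rho>" using p by (intro divide_right_mono) auto
      finally have "damp e \<rho> * (\<Sum>k<M. (1 - \<rho>) ^ k) \<le> damp e \<rho> * (1 / \<rho>)"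
        using damp_bounds[of e \<rho>] assms p by (intro mult_left_mono) auto
      also have "\<dots> = 1 / (sqrt \<rho> * sqrt (\<rho> + e))"
      proof -
        have "sqrt \<rho> * sqrt \<rho> = \<rho>" using p by simp
        then show ?thesis using p assms unfolding damp_def real_sqrt_divide
          by (simp add: divide_simps)
      qed
      finally show ?thesis by (simp add: sum_distrib_left)
    qed
  qed
  also have "F 0 = ln e" using assms by (simp add: F_def ln_sqrt)
  also have "F 1 \<le> 3"
  proof -
    have "sqrt (1 + e) \<le> 3 / 2" using assms by (intro real_le_lsqrt) (auto simp: power2_eq_square)
    moreover have "ln (1 + sqrt (1 + e)) \<le> sqrt (1 + e)" using assms by (intro ln_add_one_self_le_self) auto
    ultimately show ?thesis unfolding F_def by simp
  qed
  finally show ?thesis by simp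
qed

lemma integral_one_minus_damp_le:
  assumes "0 < e"
  shows "integral {0..1} (\<lambda>\<rho>. 1 - damp e \<rho>) \<le> e * ln ((1 + e) / e)"
proof -
  have i: "((\<lambda>\<rho>. e / (\<rho> + e)) has_integral (e * ln (1 + e) - e * ln (0 + e))) {0..1}"
    by (rule fundamental_theorem_of_calculus)
      (use assms in \<open>auto intro!: derivative_eq_intros
        simp: has_real_derivative_iff_has_vector_derivative[symmetric]\<close>)
  have "integral {0..1} (\<lambda>\<rho>. 1 - damp e \<rho>) \<le> e * ln (1 + e) - e * ln (0 + e)"
    by (rule has_integral_le[OF integrable_integral i])
      (use assms damp_bounds in \<open>auto intro!: integrable_continuous_real continuous_intros\<close>)
  also have "\<dots> = e * ln ((1 + e) / e)" using assms by (simp add: ln_div algebra_simps)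
  finally show ?thesis .
qed

section \<open>Comparison of the minorant with the truncated kernel\<close>

lemma poisson_den_pos:
  assumes "0 \<le> \<rho>" "\<rho> \<le> 1" "sin (\<theta> / 2) \<noteq> 0"
  shows "0 < poisson_den (1 - \<rho>) \<theta>"
  using poisson_den_ge_sin[OF assms(1,2), of \<theta>] assms(3) by (smt (verit) zero_less_power2)

lemma continuous_on_poisson_den [continuous_intros]:
  "continuous_on S (\<lambda>\<rho>. poisson_den (1 - \<rho>) \<theta>)"
  unfolding poisson_den_def by (intro continuous_intros)

text \<open>The pointwise error integrated over \<rho>, where (1 - \<rho>)^M contributes 1 / (M +
  1). It is used with f = 1 for the truncated kernel and with f = \<open>damp e\<close> for the
  minorant.\<close>

lemma integral_cos_power_sum_approx:
  assumes f: "continuous_on {0..1} f" and f01: "\<And>\<rho>. \<rho> \<in> {0..1} \<Longrightarrow> 0 \<le> f \<rho> \<and> f \<rho> \<le> 1"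
    and s: "sin (\<theta> / 2) \<noteq> 0"
  shows "\<bar>(\<Sum>k<M. integral {0..1} (\<lambda>\<rho>. f \<rho> * (1 - \<rho>) ^ k) * cos (real (Suc k) * \<theta>))
      - integral {0..1} (\<lambda>\<rho>. f \<rho> * ((cos \<theta> - (1 - \<rho>)) / poisson_den (1 - \<rho>) \<theta>))\<bar>
    \<le> 1 / (real (Suc M) * \<bar>sin (\<theta> / 2)\<bar>)"
proof -
  let ?D = "\<lambda>\<rho>. poisson_den (1 - \<rho>) \<theta>"
  let ?K = "\<lambda>\<rho>. f \<rho> * ((cos \<theta> - (1 - \<rho>)) / ?D \<rho>)"
  let ?S = "\<lambda>\<rho>. \<Sum>k<M. f \<rho> * (1 - \<rho>) ^ k * cos (real (Suc k) * \<theta>)"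
  have D0: "0 < ?D \<rho>" if "\<rho> \<in> {0..1}" for \<rho> using poisson_den_pos[of \<rho> \<theta>] that s by auto
  have iK: "?K integrable_on {0..1}"
    by (intro integrable_continuous_real continuous_intros f) (use D0 in force)
  have iS: "(?S has_integral
      (\<Sum>k<M. integral {0..1} (\<lambda>\<rho>. f \<rho> * (1 - \<rho>) ^ k) * cos (real (Suc k) * \<theta>))) {0..1}"
    by (intro has_integral_sum has_integral_mult_left integrable_integral
        integrable_continuous_real continuous_intros f) auto
  have iT: "((\<lambda>\<rho>. (1 - \<rho>) ^ M * (1 / \<bar>sin (\<theta> / 2)\<bar>)) has_integral
      (1 - 0) ^ Suc M / real (Suc M) * (1 / \<bar>sin (\<theta> / 2)\<bar>)) {0..1}"
    by (intro has_integral_mult_left has_integral_power_one_minus) simp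
  have "norm (integral {0..1} (\<lambda>\<rho>. ?S \<rho> - ?K \<rho>)) \<le> integral {0..1} (\<lambda>\<rho>. (1 - \<rho>) ^ M * (1 / \<bar>sin (\<theta> / 2)\<bar>))"
  proof (rule integral_norm_bound_integral)
    show "(\<lambda>\<rho>. ?S \<rho> - ?K \<rho>) integrable_on {0..1}"
      by (intro integrable_diff has_integral_integrable[OF iS] iK)
    show "(\<lambda>\<rho>. (1 - \<rho>) ^ M * (1 / \<bar>sin (\<theta> / 2)\<bar>)) integrable_on {0..1}"
      using iT by blast
    fix \<rho> :: real assume r: "\<rho> \<in> {0..1}"
    define X where "X = (\<Sum>k<M. (1 - \<rho>) ^ k * cos (real (Suc k) * \<theta>)) - (cos \<theta> - (1 - \<rho>)) / ?D \<rho>"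
    have "?S \<rho> - ?K \<rho> = f \<rho> * X"
      unfolding X_def by (simp add: right_diff_distrib sum_distrib_left mult.assoc)
    then have "norm (?S \<rho> - ?K \<rho>) \<le> \<bar>X\<bar>"
      using f01[OF r] by (simp add: abs_mult mult_left_le_one_le)
    also have "\<dots> \<le> (1 - \<rho>) ^ M / sqrt (?D \<rho>)"
      unfolding X_def using cos_power_sum_approx[of "1 - \<rho>" \<theta> M] D0[OF r] r by simp
    also have "\<dots> \<le> (1 - \<rho>) ^ M / \<bar>sin (\<theta> / 2)\<bar>"
      using poisson_den_ge_sin[of \<rho> \<theta>] r s
      by (intro divide_left_mono mult_pos_pos) (auto intro!: real_le_rsqrt D0[OF r])
    finally show "norm (?S \<rho> - ?K \<rho>) \<le> (1 - \<rho>) ^ M * (1 / \<bar>sin (\<theta> / 2)\<bar>)" by simp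
  qed
  also have "\<dots> = 1 / (real (Suc M) * \<bar>sin (\<theta> / 2)\<bar>)"
    using integral_unique[OF iT] by simp
  also have "integral {0..1} (\<lambda>\<rho>. ?S \<rho> - ?K \<rho>) = integral {0..1} ?S - integral {0..1} ?K"
    by (rule integral_diff[OF has_integral_integrable[OF iS] iK])
  finally show ?thesis using integral_unique[OF iS] by simp
qed

text \<open>The first term is the gain that will pay for the truncation of the kernel. It comes from
  the Poisson part on 0 \<le> \<rho> \<le> s, s = |sin (\<theta> / 2)|, where the denominator is at
  most 5 s^2; the second term is the price of the constant 3/2.\<close>

lemma integral_damped_kernel_ge:
  assumes e: "0 < e" and s0: "sin (\<theta> / 2) \<noteq> 0"
  shows "e / (40 * (\<bar>sin (\<theta> / 2)\<bar> + e)) - 3 / 2 * (e * ln ((1 + e) / e))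
    \<le> integral {0..1} (\<lambda>\<rho>. (1 - damp e \<rho>) * ((cos \<theta> - (1 - \<rho>)) / poisson_den (1 - \<rho>) \<theta>))"
proof -
  define s where "s = \<bar>sin (\<theta> / 2)\<bar>"
  have s: "0 < s" "s \<le> 1" "s\<^sup>2 = (sin (\<theta> / 2))\<^sup>2" using s0 by (auto simp: s_def)
  let ?D = "\<lambda>\<rho>. poisson_den (1 - \<rho>) \<theta>"
  define P where "P \<rho> = (1 - damp e \<rho>) * ((1 - (1 - \<rho>)\<^sup>2) / (2 * ?D \<rho>))" for \<rho>
  have D0: "0 < ?D \<rho>" if "\<rho> \<in> {0..1}" for \<rho> using poisson_den_pos[of \<rho> \<theta>] that s0 by auto
  have iP: "P integrable_on {0..1}"
    unfolding P_def by (intro integrable_continuous_real continuous_intros e) (use D0 in force)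
  have iK: "(\<lambda>\<rho>. (1 - damp e \<rho>) * ((cos \<theta> - (1 - \<rho>)) / ?D \<rho>)) integrable_on {0..1}"
    by (intro integrable_continuous_real continuous_intros e) (use D0 in force)
  have id: "(\<lambda>\<rho>. 1 - damp e \<rho>) integrable_on {0..1}"
    by (intro integrable_continuous_real continuous_intros e)
  have P0: "0 \<le> P \<rho>" if "\<rho> \<in> {0..1}" for \<rho>
  proof -
    have "(1 - \<rho>)\<^sup>2 \<le> 1" using that by (simp add: power_le_one)
    then show ?thesis unfolding P_def using that damp_bounds(2)[of e \<rho>] e D0[OF that]
      by (intro mult_nonneg_nonneg divide_nonneg_pos) auto
  qed
  \<comment> \<open>The 20 is a 2 from \<open>damp_bounds\<close> times the 2 * 5 from the Poisson
    part; integrating \<rho> up to s gives s^2 / 2 and hence 40.\<close>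
  have "((\<lambda>\<rho>. e / (s + e) / (20 * s\<^sup>2) * \<rho>) has_integral e / (s + e) / (20 * s\<^sup>2) * ((s\<^sup>2 - 0\<^sup>2) / 2)) {0..s}"
    using s(1) by (intro has_integral_mult_right ident_has_integral less_imp_le)
  then have "e / (s + e) / (20 * s\<^sup>2) * ((s\<^sup>2 - 0\<^sup>2) / 2) \<le> integral {0..s} P"
  proof (rule has_integral_le[OF _ integrable_integral])
    show "P integrable_on {0..s}" using iP by (rule integrable_on_subinterval) (use s in auto)
    fix \<rho> assume "\<rho> \<in> {0..s}"
    then have r: "0 \<le> \<rho>" "\<rho> \<le> s" "\<rho> \<in> {0..1}" using s by auto
    have "e / (s + e) \<le> e / (\<rho> + e)" using r e s by (intro divide_left_mono mult_pos_pos) auto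
    then have "e / (s + e) / 2 \<le> e / (\<rho> + e) / 2" by (rule divide_right_mono) simp
    then have 1: "e / (s + e) / 2 \<le> 1 - damp e \<rho>" using damp_bounds(3)[OF e r(1)] by linarith
    have "?D \<rho> \<le> 5 * s\<^sup>2"
      using poisson_den_le_sin[OF r(1), of \<theta>] power_mono[OF r(2) r(1), of 2] s by simp
    then have "\<rho> / (2 * (5 * s\<^sup>2)) \<le> \<rho> / (2 * ?D \<rho>)"
      using D0[OF r(3)] r s by (intro divide_left_mono mult_pos_pos) auto
    also have "\<dots> \<le> (1 - (1 - \<rho>)\<^sup>2) / (2 * ?D \<rho>)"
      using D0[OF r(3)] r
      by (intro divide_right_mono) (auto simp: power2_eq_square algebra_simps mult_left_le)
    finally have 2: "\<rho> / (2 * (5 * s\<^sup>2)) \<le> (1 - (1 - \<rho>)\<^sup>2) / (2 * ?D \<rho>)" .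
    have "e / (s + e) / 2 * (\<rho> / (2 * (5 * s\<^sup>2))) \<le> P \<rho>"
      unfolding P_def by (rule mult_mono[OF 1 2]) (use r e s damp_bounds(2)[OF e r(1)] in auto)
    moreover have "a / 2 * (\<rho> / (2 * (5 * b))) = a / (20 * b) * \<rho>" for a b :: real by simp
    ultimately show "e / (s + e) / (20 * s\<^sup>2) * \<rho> \<le> P \<rho>" by metis
  qed
  also have "\<dots> \<le> integral {0..1} P"
    by (rule integral_subset_le)
      (use s iP P0 integrable_on_subinterval[OF iP, of 0 s] in auto)
  also have "e / (s + e) / (20 * s\<^sup>2) * ((s\<^sup>2 - 0\<^sup>2) / 2) = e / (40 * (s + e))"
    using s(1) by simp
  finally have "e / (40 * (s + e)) \<le> integral {0..1} P" .
  moreover have "integral {0..1} (\<lambda>\<rho>. P \<rho> - 3 / 2 * (1 - damp e \<rho>))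
      = integral {0..1} P - 3 / 2 * integral {0..1} (\<lambda>\<rho>. 1 - damp e \<rho>)"
    by (simp only: integral_diff[OF iP integrable_on_mult_right[OF id]] integral_mult_right)
  moreover have "integral {0..1} (\<lambda>\<rho>. P \<rho> - 3 / 2 * (1 - damp e \<rho>))
      \<le> integral {0..1} (\<lambda>\<rho>. (1 - damp e \<rho>) * ((cos \<theta> - (1 - \<rho>)) / ?D \<rho>))"
  proof (rule integral_le[OF _ iK])
    show "(\<lambda>\<rho>. P \<rho> - 3 / 2 * (1 - damp e \<rho>)) integrable_on {0..1}"
      by (intro integrable_diff iP integrable_on_mult_right id)
    fix \<rho> :: real assume r: "\<rho> \<in> {0..1}"
    have "P \<rho> - 3 / 2 * (1 - damp e \<rho>)
        = (1 - damp e \<rho>) * ((1 - (1 - \<rho>)\<^sup>2) / (2 * ?D \<rho>) - 3 / 2)"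
      unfolding P_def by (simp only: right_diff_distrib mult.commute)
    also have "\<dots> \<le> (1 - damp e \<rho>) * ((cos \<theta> - (1 - \<rho>)) / ?D \<rho>)"
      using conjugate_kernel_ge[of "1 - \<rho>" \<theta>] D0[OF r] r damp_bounds(2)[OF e, of \<rho>]
      by (intro mult_left_mono) auto
    finally show "P \<rho> - 3 / 2 * (1 - damp e \<rho>) \<le> (1 - damp e \<rho>) * ((cos \<theta> - (1 - \<rho>)) / ?D \<rho>)" .
  qed
  ultimately show ?thesis
    using integral_one_minus_damp_le[OF e] unfolding s_def[symmetric] by linarith
qed

text \<open>With s = |sin (\<theta> / 2)|, truncation costs at most 1 / (N s), while the gain is c /
  (40 (N s + c)). The gain wins as soon as both c and N s are at least 80.\<close>

lemma coef_cos_sum_le_far: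
  assumes c: "80 \<le> c" and N: "c \<le> real N" and far: "80 \<le> real N * \<bar>sin (\<theta> / 2)\<bar>"
  shows "(\<Sum>k<M. coef (c / real N) k * cos (real (Suc k) * \<theta>))
    \<le> (\<Sum>k<N. cos (real (Suc k) * \<theta>) / real (Suc k)) + 3 / 2 * c * (ln (real N) / real N)
      + 1 / (real (Suc M) * \<bar>sin (\<theta> / 2)\<bar>)"
proof -
  define s where "s = \<bar>sin (\<theta> / 2)\<bar>"
  define n where "n = real N"
  define e where "e = c / n"
  have n: "0 < n" "c \<le> n" using c N by (auto simp: n_def)
  have e: "0 < e" "e \<le> 1" using n c by (auto simp: e_def)
  have s0: "sin (\<theta> / 2) \<noteq> 0" using far by auto
  then have s: "0 < s" by (simp add: s_def)
  let ?K = "\<lambda>\<rho>. (cos \<theta> - (1 - \<rho>)) / poisson_den (1 - \<rho>) \<theta>"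
  have D0: "poisson_den (1 - \<rho>) \<theta> \<noteq> 0" if "\<rho> \<in> {0..1}" for \<rho>
    using poisson_den_pos[of \<rho> \<theta>] that s0 by force
  have "\<bar>(\<Sum>k<N. integral {0..1} (\<lambda>\<rho>. 1 * (1 - \<rho>) ^ k) * cos (real (Suc k) * \<theta>)) - integral {0..1} (\<lambda>\<rho>. 1 * ?K \<rho>)\<bar>
      \<le> 1 / (real (Suc N) * s)"
    unfolding s_def by (rule integral_cos_power_sum_approx) (auto simp: s0)
  moreover have "integral {0..1} (\<lambda>\<rho>::real. 1 * (1 - \<rho>) ^ k) = 1 / real (Suc k)" for k
    using integral_unique[OF has_integral_power_one_minus[of 0 k]] by simp
  ultimately have 1: "integral {0..1} ?K - 1 / (real (Suc N) * s) \<le> (\<Sum>k<N. cos (real (Suc k) * \<theta>) / real (Suc k))"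
    by simp
  have 2: "(\<Sum>k<M. coef e k * cos (real (Suc k) * \<theta>))
      \<le> integral {0..1} (\<lambda>\<rho>. damp e \<rho> * ?K \<rho>) + 1 / (real (Suc M) * s)"
    using integral_cos_power_sum_approx[OF continuous_on_damp[OF e(1)] _ s0, of M] damp_bounds[OF e(1)]
    unfolding coef_def s_def[symmetric] by force
  have i1: "(\<lambda>\<rho>. damp e \<rho> * ?K \<rho>) integrable_on {0..1}" and i2: "?K integrable_on {0..1}"
    using D0 by (auto intro!: integrable_continuous_real continuous_intros e)
  have "integral {0..1} (\<lambda>\<rho>. (1 - damp e \<rho>) * ?K \<rho>)
      = integral {0..1} ?K - integral {0..1} (\<lambda>\<rho>. damp e \<rho> * ?K \<rho>)"
    unfolding left_diff_distrib mult_1 by (rule integral_diff[OF i2 i1])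
  then have 3: "e / (40 * (s + e)) - 3 / 2 * (e * ln ((1 + e) / e))
      \<le> integral {0..1} ?K - integral {0..1} (\<lambda>\<rho>. damp e \<rho> * ?K \<rho>)"
    using integral_damped_kernel_ge[OF e(1) s0] unfolding s_def[symmetric] by linarith
  have 4: "1 / (real (Suc N) * s) \<le> e / (40 * (s + e))"
  proof -
    have "1 / (real (Suc N) * s) \<le> 1 / (n * s)"
      using s n by (intro divide_left_mono mult_pos_pos mult_right_mono) (auto simp: n_def)
    also have "\<dots> \<le> c / (40 * (n * s + c))"
    proof -
      have "1 / y \<le> c / (40 * (y + c))" if y: "80 \<le> y" for y :: real
      proof -
        have "80 * y \<le> c * y" "c * 80 \<le> c * y"
          by (intro mult_right_mono[OF c] mult_left_mono[OF y], use y c in linarith)+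
        then have "(80 * y + c * 80) / 2 \<le> (c * y + c * y) / 2"
          by (intro divide_right_mono add_mono) auto
        then have "40 * (y + c) \<le> c * y" by simp
        then have "1 / y * (40 * (y + c)) \<le> c"
          using y by (simp add: pos_divide_le_eq)
        then show ?thesis using y c by (subst pos_le_divide_eq) auto
      qed
      then show ?thesis using far by (simp add: n_def s_def)
    qed
    also have "\<dots> = e / (40 * (s + e))" 
    proof -
      have "n * s + c = n * (s + e)" using n by (simp add: e_def algebra_simps)
      then show ?thesis using n by (simp add: e_def)
    qed
    finally show ?thesis .
  qed
  have "ln ((1 + e) / e) \<le> ln n"
  proof -
    have "(1 + e) / e \<le> 2 / e" using e by (intro divide_right_mono) auto
    also have "\<dots> \<le> n" using c n by (simp add: e_def field_simps)
    finally show ?thesis using e n by (subst ln_le_cancel_iff) auto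
  qed
  then have "3 / 2 * (e * ln ((1 + e) / e)) \<le> 3 / 2 * (e * ln n)" using e by (intro mult_left_mono) auto
  also have "\<dots> = 3 / 2 * c * (ln n / n)" by (simp add: e_def)
  finally have "3 / 2 * (e * ln ((1 + e) / e)) \<le> 3 / 2 * c * (ln n / n)" .
  then show ?thesis using 1 2 3 4 unfolding e_def n_def s_def by linarith
qed

text \<open>Comes from |sin (k x)| \<le> k |sin x|. In terms of sin (\<theta> / 2) the bound is
  periodic, so \<theta> need not be reduced.\<close>

lemma one_minus_cos_le: "1 - cos (real k * \<theta>) \<le> 2 * (real k * sin (\<theta> / 2))\<^sup>2"
proof -
  have "\<bar>sin (real k * (\<theta> / 2))\<bar> \<le> real k * \<bar>sin (\<theta> / 2)\<bar>"
  proof (induction k)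
    case (Suc k)
    have "real (Suc k) * (\<theta> / 2) = real k * (\<theta> / 2) + \<theta> / 2" by (simp add: algebra_simps)
    then have "\<bar>sin (real (Suc k) * (\<theta> / 2))\<bar>
        \<le> \<bar>sin (real k * (\<theta> / 2))\<bar> * \<bar>cos (\<theta> / 2)\<bar> + \<bar>cos (real k * (\<theta> / 2))\<bar> * \<bar>sin (\<theta> / 2)\<bar>"
      unfolding abs_mult[symmetric] by (metis sin_add abs_triangle_ineq)
    also have "\<dots> \<le> \<bar>sin (real k * (\<theta> / 2))\<bar> * 1 + 1 * \<bar>sin (\<theta> / 2)\<bar>"
      by (intro add_mono mult_mono) auto
    finally show ?case using Suc.IH by (simp add: algebra_simps)
  qed simp
  then have "(sin (real k * (\<theta> / 2)))\<^sup>2 \<le> (real k * \<bar>sin (\<theta> / 2)\<bar>)\<^sup>2"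
    by (simp add: abs_le_square_iff[symmetric] abs_mult)
  then show ?thesis using cos_eq_sin_half[of "real k * \<theta>"] by (simp add: power_mult_distrib)
qed

text \<open>
  Here the minorant lies below the kernel simply because its value at the origin is smaller; this is
  what forces \<open>c\<close> to be so large: \<open>12803 = 2 * 80\<^sup>2 + 3\<close>.
\<close>

lemma coef_cos_sum_le_near:
  assumes c: "exp 12803 \<le> c" and N: "c \<le> real N" and near: "real N * \<bar>sin (\<theta> / 2)\<bar> \<le> 80"
  shows "(\<Sum>k<M. coef (c / real N) k * cos (real (Suc k) * \<theta>))
    \<le> (\<Sum>k<N. cos (real (Suc k) * \<theta>) / real (Suc k))"
proof -
  define s where "s = \<bar>sin (\<theta> / 2)\<bar>"
  have "0 < c" using c exp_gt_zero[of 12803] by linarith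
  then have n: "0 < real N" using N by linarith
  then have e: "0 < c / real N" "c / real N \<le> 1" using \<open>0 < c\<close> N by auto
  have lc: "12803 \<le> ln c" using c \<open>0 < c\<close> by (simp add: ln_ge_iff)
  have "(\<Sum>k<M. coef (c / real N) k * cos (real (Suc k) * \<theta>)) \<le> (\<Sum>k<M. coef (c / real N) k)"
    using coef_nonneg[OF e(1)] by (intro sum_mono) (simp add: mult_left_le)
  also have "\<dots> \<le> 3 - ln (c / real N)" by (rule sum_coef_le[OF e])
  also have "\<dots> \<le> ln (real N) - 12800" using \<open>0 < c\<close> n lc by (simp add: ln_div)
  also have "\<dots> \<le> (\<Sum>k<N. cos (real (Suc k) * \<theta>) / real (Suc k))"
  proof -
    \<comment> \<open>The drop of the kernel from its value at the origin: every frequency loses at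
      most 2 N s^2, in total 2 (N s)^2, which is at most 12800.\<close>
    have "(\<Sum>k<N. 1 / real (Suc k) - cos (real (Suc k) * \<theta>) / real (Suc k)) \<le> (\<Sum>k<N. 2 * real N * s\<^sup>2)"
    proof (rule sum_mono)
      fix k assume "k \<in> {..<N}"
      then have k: "real (Suc k) \<le> real N" by simp
      have "1 / real (Suc k) - cos (real (Suc k) * \<theta>) / real (Suc k)
          \<le> 2 * (real (Suc k) * sin (\<theta> / 2))\<^sup>2 / real (Suc k)"
        unfolding diff_divide_distrib[symmetric] by (intro divide_right_mono one_minus_cos_le) simp
      also have "\<dots> = 2 * real (Suc k) * s\<^sup>2" unfolding s_def by (simp add: power2_eq_square field_simps)
      also have "\<dots> \<le> 2 * real N * s\<^sup>2" using k by (intro mult_right_mono) auto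
      finally show "1 / real (Suc k) - cos (real (Suc k) * \<theta>) / real (Suc k) \<le> 2 * real N * s\<^sup>2" .
    qed
    also have "\<dots> = 2 * (real N * s)\<^sup>2" by (simp add: power2_eq_square)
    also have "\<dots> \<le> 2 * 80\<^sup>2" using near n unfolding s_def by (intro mult_left_mono power_mono) auto
    finally have "(\<Sum>k<N. 1 / real (Suc k)) - 12800 \<le> (\<Sum>k<N. cos (real (Suc k) * \<theta>) / real (Suc k))"
      by (simp add: sum_subtractf)
    moreover have "ln (real N) \<le> (\<Sum>k<N. 1 / real (Suc k))"
    proof -
      have "ln (real N) \<le> ln (real N + 1)" using n by simp
      also have "\<dots> \<le> harm N" by (rule ln_le_harm)
      also have "harm N = (\<Sum>k<N. 1 / real (Suc k))"
        unfolding harm_def by (simp add: sum.atLeast1_atMost_eq inverse_eq_divide)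
      finally show ?thesis .
    qed
    ultimately show ?thesis by linarith
  qed
  finally show ?thesis .
qed

text \<open>The error 1 / ((M + 1) |sin (\<theta> / 2)|) of the far case tends to 0, but not
  uniformly in \<theta>; hence the bound is only eventual in M. The error is absorbed by raising 3/2
  to 2.\<close>

lemma eventually_coef_cos_sum_le:
  assumes c: "exp 12803 \<le> c" and N: "c \<le> real N"
  shows "\<forall>\<^sub>F M in sequentially. (\<Sum>k<M. coef (c / real N) k * cos (real (Suc k) * \<theta>))
    \<le> (\<Sum>k<N. cos (real (Suc k) * \<theta>) / real (Suc k)) + 2 * c * (ln (real N) / real N)"
proof -
  have c80: "80 \<le> c" using c exp_ge_add_one_self[of 12803] by linarith
  then have n: "0 < ln (real N)" "0 < real N" using N by (auto intro: ln_gt_zero)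
  then have p: "0 < c * (ln (real N) / real N)" using c80 by (intro mult_pos_pos divide_pos_pos) auto
  show ?thesis
  proof (cases "80 \<le> real N * \<bar>sin (\<theta> / 2)\<bar>")
    case True
    have "(\<lambda>M. 1 / (real (Suc M) * \<bar>sin (\<theta> / 2)\<bar>)) \<longlonglongrightarrow> 0"
      using tendsto_mult_right_zero[OF LIMSEQ_inverse_real_of_nat, of "1 / \<bar>sin (\<theta> / 2)\<bar>"]
      by (simp add: field_simps)
    then have "\<forall>\<^sub>F M in sequentially. 1 / (real (Suc M) * \<bar>sin (\<theta> / 2)\<bar>) < 1 / 2 * (c * (ln (real N) / real N))"
      using mult_pos_pos[OF _ p, of "1 / 2"] by (intro order_tendstoD(2)) simp_all
    then show ?thesis
    proof eventually_elim
      case (elim M)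
      then show ?case using coef_cos_sum_le_far[OF c80 N True, of M] by simp
    qed
  next
    case False
    then show ?thesis
      using p by (intro always_eventually allI order.trans[OF coef_cos_sum_le_near[OF c N]]) auto
  qed
qed

section \<open>Growth of the energy\<close>

definition weyl :: "(nat \<Rightarrow> real) \<Rightarrow> nat \<Rightarrow> nat \<Rightarrow> complex" where
  "weyl x N j = (\<Sum>n = 1..N. cis (2 * pi * real j * x n))"

text \<open>Cutting off at M keeps the energy a finite sum, so no convergence has to be
  discussed.\<close>

definition energy :: "real \<Rightarrow> (nat \<Rightarrow> real) \<Rightarrow> nat \<Rightarrow> nat \<Rightarrow> real" where
  "energy c x M N = (\<Sum>k<M. coef (c / real N) k * (cmod (weyl x N (Suc k)))\<^sup>2)"

lemma weyl_Suc_norm: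
  "(cmod (weyl x (Suc N) j))\<^sup>2
    = (cmod (weyl x N j))\<^sup>2 + 2 * (\<Sum>n = 1..N. cos (2 * pi * real j * (x (Suc N) - x n))) + 1"
proof -
  define a where "a n = 2 * pi * real j * x n" for n
  have "(\<Sum>n = 1..N. cos (2 * pi * real j * (x (Suc N) - x n)))
      = (\<Sum>n = 1..N. cos (a (Suc N)) * cos (a n) + sin (a (Suc N)) * sin (a n))"
    unfolding a_def right_diff_distrib cos_diff ..
  also have "\<dots> = cos (a (Suc N)) * (\<Sum>n = 1..N. cos (a n)) + sin (a (Suc N)) * (\<Sum>n = 1..N. sin (a n))"
    by (simp add: sum.distrib sum_distrib_left)
  finally have e: "(\<Sum>n = 1..N. cos (2 * pi * real j * (x (Suc N) - x n))) = \<dots>" .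
  define C S where "C = (\<Sum>n = 1..N. cos (a n))" "S = (\<Sum>n = 1..N. sin (a n))"
  have "(C + cos (a (Suc N)))\<^sup>2 + (S + sin (a (Suc N)))\<^sup>2
      = C\<^sup>2 + S\<^sup>2 + 2 * (cos (a (Suc N)) * C + sin (a (Suc N)) * S) + ((sin (a (Suc N)))\<^sup>2 + (cos (a (Suc N)))\<^sup>2)"
    by algebra
  then show ?thesis
    unfolding e unfolding weyl_def a_def[symmetric] C_S_def[symmetric] cmod_power2
    by (simp add: C_S_def add.commute)
qed

lemma norm_weyl_le: "cmod (weyl x N j) \<le> real N"
  unfolding weyl_def by (rule order.trans[OF norm_sum]) simp

text \<open>Starting point of the induction on N.\<close>

lemma energy_trivial_bound:
  assumes "0 < c" "c \<le> real N"
  shows "energy c x M N \<le> (real N)\<^sup>2 * (3 - ln (c / real N))"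
proof -
  have e: "0 < c / real N" "c / real N \<le> 1" using assms by auto
  have "energy c x M N \<le> (\<Sum>k<M. coef (c / real N) k * (real N)\<^sup>2)"
    unfolding energy_def using coef_nonneg[OF e(1)]
    by (intro sum_mono mult_left_mono power_mono norm_weyl_le) auto
  also have "\<dots> = (\<Sum>k<M. coef (c / real N) k) * (real N)\<^sup>2" by (simp add: sum_distrib_right)
  also have "\<dots> \<le> (3 - ln (c / real N)) * (real N)\<^sup>2" by (intro mult_right_mono sum_coef_le e) simp
  finally show ?thesis by (simp add: mult.commute)
qed

lemma energy_mono:
  assumes "0 < c" "0 < N" "M \<le> M'"
  shows "energy c x M N \<le> energy c x M' N"
  unfolding energy_def using assms by (intro sum_mono2) (auto intro!: mult_nonneg_nonneg coef_nonneg)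

text \<open>The new energy splits into old squares with larger coefficients, twice a cross term, and
  the sum of all coefficients. By the minorant property at the N differences the cross term is at
  most the greedy sum plus 2 c ln (N + 1); doubling gives 4 c, and the coefficients contribute the
  1.\<close>

lemma energy_Suc_le:
  assumes c: "exp 12803 \<le> c" and N: "c \<le> real N" and N1: "1 \<le> N"
    and greedy: "(\<Sum>n = 1..N. \<Sum>k = 1..Suc N. cos (2 * pi * real k * (x (Suc N) - x n)) / real k) \<le> 0"
    and M: "\<And>n. n \<in> {1..N} \<Longrightarrow>
      (\<Sum>k<M. coef (c / real (Suc N)) k * cos (real (Suc k) * (2 * pi * (x (Suc N) - x n))))
      \<le> (\<Sum>k<Suc N. cos (real (Suc k) * (2 * pi * (x (Suc N) - x n))) / real (Suc k))
         + 2 * c * (ln (real (Suc N)) / real (Suc N))"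
  shows "energy c x M (Suc N) \<le> sqrt (real (Suc N) / real N) * energy c x M N
    + (4 * c + 1) * ln (real (Suc N))"
proof -
  define L where "L = ln (real (Suc N))"
  define e where "e = c / real (Suc N)"
  have c1: "0 < c" using c exp_gt_zero[of 12803] by linarith
  have e: "0 < e" "e \<le> 1" using c1 N by (auto simp: e_def)
  have "energy c x M (Suc N) = (\<Sum>k<M. coef e k * (cmod (weyl x N (Suc k)))\<^sup>2)
      + 2 * (\<Sum>k<M. coef e k * (\<Sum>n = 1..N. cos (2 * pi * real (Suc k) * (x (Suc N) - x n))))
      + (\<Sum>k<M. coef e k)"
    unfolding energy_def weyl_Suc_norm e_def
    by (simp add: distrib_left sum.distrib sum_distrib_left mult_ac)
  also have "(\<Sum>k<M. coef e k * (\<Sum>n = 1..N. cos (2 * pi * real (Suc k) * (x (Suc N) - x n))))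
      = (\<Sum>n = 1..N. \<Sum>k<M. coef e k * cos (real (Suc k) * (2 * pi * (x (Suc N) - x n))))"
  proof -
    have "2 * pi * real (Suc k) * y = real (Suc k) * (2 * pi * y)" for k y by (simp only: mult_ac)
    then show ?thesis unfolding sum_distrib_left by (simp only:) (rule sum.swap)
  qed
  also have "\<dots> \<le> (\<Sum>n = 1..N. (\<Sum>k<Suc N. cos (real (Suc k) * (2 * pi * (x (Suc N) - x n))) / real (Suc k))
         + 2 * c * (L / real (Suc N)))"
    unfolding L_def e_def by (intro sum_mono M)
  also have "\<dots> = (\<Sum>n = 1..N. \<Sum>k = 1..Suc N. cos (2 * pi * real k * (x (Suc N) - x n)) / real k)
         + real N / real (Suc N) * (2 * c * L)"
    by (simp add: sum.distrib sum.atLeast1_atMost_eq mult_ac del: sum.lessThan_Suc sum.cl_ivl_Suc)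
  also have "\<dots> \<le> 0 + 1 * (2 * c * L)"
    using greedy c1 by (intro add_mono mult_right_mono) (auto simp: L_def)
  also have "(\<Sum>k<M. coef e k * (cmod (weyl x N (Suc k)))\<^sup>2) \<le> sqrt (real (Suc N) / real N) * energy c x M N"
  proof -
    have "coef e k \<le> sqrt (real (Suc N) / real N) * coef (c / real N) k" for k
    proof -
      have "(c / real N) / e = real (Suc N) / real N" using c1 by (simp add: e_def)
      then show ?thesis using coef_scale[of e "c / real N" k] e c1 N1
        by (simp add: e_def frac_le)
    qed
    then show ?thesis
      unfolding energy_def sum_distrib_left mult.assoc[symmetric]
      by (intro sum_mono mult_right_mono) auto
  qed
  \<comment> \<open>The bound 3 - ln e equals 3 - ln c + L, and ln c exceeds 3.\<close>
  also have "(\<Sum>k<M. coef e k) \<le> L"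
    using sum_coef_le[OF e, of M] c c1 ln_ge_iff[of c 12803] by (simp add: e_def ln_div L_def)
  finally show ?thesis by (simp add: L_def algebra_simps)
qed

text \<open>Since sqrt ((n + 1) / n) * n \<le> n + 1/2, half of the increase from A n to A (n + 1)
  remains to absorb B. This is where the square root in \<open>damp\<close> pays: a factor (n + 1) /
  n would use up the whole increase.\<close>

lemma energy_induction_step:
  assumes "0 \<le> B" "2 * B \<le> A" "1 \<le> N" "E \<le> A * real N * ln (real N)"
  shows "sqrt (real (Suc N) / real N) * E + B * ln (real (Suc N)) \<le> A * real (Suc N) * ln (real (Suc N))"
proof -
  define n where "n = real N"
  have n: "1 \<le> n" "real (Suc N) = n + 1" using assms by (auto simp: n_def)
  have ln: "0 \<le> ln n" "ln n \<le> ln (n + 1)" using n by auto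
  have q: "sqrt ((n + 1) / n) * n \<le> n + 1 / 2"
  proof -
    have "sqrt ((n + 1) / n) * n = sqrt ((n + 1) * n)"
      using n by (simp add: real_sqrt_divide real_sqrt_mult) (simp add: field_simps)
    also have "\<dots> \<le> n + 1 / 2" using n by (intro real_le_lsqrt) (auto simp: power2_eq_square algebra_simps)
    finally show ?thesis .
  qed
  have "sqrt ((n + 1) / n) * E \<le> sqrt ((n + 1) / n) * (A * n * ln n)"
    using assms n unfolding n_def by (intro mult_left_mono) auto
  also have "\<dots> = A * ((sqrt ((n + 1) / n) * n) * ln n)" by (simp add: mult_ac)
  also have "\<dots> \<le> A * ((n + 1 / 2) * ln (n + 1))"
    using q ln n assms by (intro mult_left_mono mult_mono) auto
  finally have "sqrt ((n + 1) / n) * E + B * ln (n + 1) \<le> A * ((n + 1 / 2) * ln (n + 1)) + A / 2 * ln (n + 1)"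
    using assms ln by (intro add_mono mult_right_mono) auto
  also have "\<dots> = A * (n + 1) * ln (n + 1)" by (simp add: algebra_simps)
  finally show ?thesis using n(2) by (simp add: n_def add.commute)
qed

text \<open>Each step involves finitely many angles, so finitely many eventual statements in M are
  intersected. The first condition on A serves the start of the induction, the second its
  step.\<close>

lemma eventually_energy_le:
  fixes x :: "nat \<Rightarrow> real"
  assumes greedy: "\<And>N. N \<ge> 2 \<Longrightarrow>
      (\<Sum>n = 1..N - 1. \<Sum>k = 1..N. cos (2 * pi * real k * (x N - x n)) / real k) \<le> 0"
    and c: "exp 12803 \<le> c" and N0: "c \<le> real N0"
    and A: "real N0 \<le> A" "2 * (4 * c + 1) \<le> A" and N: "N0 \<le> N"
  shows "\<forall>\<^sub>F M in sequentially. energy c x M N \<le> A * real N * ln (real N)"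
  using N
proof (induction N rule: dec_induct)
  case base
  have c0: "0 < c" using c exp_gt_zero[of 12803] by linarith
  then have lnc: "12803 \<le> ln c" using c by (simp add: ln_ge_iff)
  have p: "0 < real N0" using c0 N0 by linarith
  have "energy c x M N0 \<le> A * real N0 * ln (real N0)" for M
  proof -
    have l: "0 \<le> ln (real N0)" using p by simp
    have "energy c x M N0 \<le> (real N0)\<^sup>2 * (3 - ln (c / real N0))"
      by (rule energy_trivial_bound[OF c0 N0])
    also have "\<dots> \<le> (real N0)\<^sup>2 * ln (real N0)"
      using lnc c0 p by (intro mult_left_mono) (auto simp: ln_div)
    also have "\<dots> = real N0 * (real N0 * ln (real N0))" by (simp add: power2_eq_square)
    also have "\<dots> \<le> A * (real N0 * ln (real N0))" using A p l by (intro mult_right_mono) auto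
    finally show ?thesis by (simp add: mult.assoc)
  qed
  then show ?case by simp
next
  case (step N)
  have c0: "0 < c" using c exp_gt_zero[of 12803] by linarith
  have cN: "c \<le> real N" using N0 step.hyps by linarith
  then have N1: "1 \<le> N" using c0 by (cases N) auto
  have "\<forall>\<^sub>F M in sequentially. \<forall>n\<in>{1..N}.
      (\<Sum>k<M. coef (c / real (Suc N)) k * cos (real (Suc k) * (2 * pi * (x (Suc N) - x n))))
      \<le> (\<Sum>k<Suc N. cos (real (Suc k) * (2 * pi * (x (Suc N) - x n))) / real (Suc k))
         + 2 * c * (ln (real (Suc N)) / real (Suc N))"
    using cN by (intro eventually_ball_finite ballI eventually_coef_cos_sum_le c) auto
  with step.IH show ?case
  proof eventually_elim
    case (elim M)
    have "energy c x M (Suc N) \<le> sqrt (real (Suc N) / real N) * energy c x M N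
        + (4 * c + 1) * ln (real (Suc N))"
      by (rule energy_Suc_le[OF c cN N1]) (use greedy[of "Suc N"] N1 elim in auto)
    also have "\<dots> \<le> A * real (Suc N) * ln (real (Suc N))"
      by (rule energy_induction_step) (use c0 A N1 elim in auto)
    finally show ?case .
  qed
qed

text \<open>The energy grows with M, so an eventual bound holds for every M; \<open>coef_ge\<close>
  with a = 1 / N then makes the weights explicit at the cost of a constant factor.\<close>

lemma greedy_weyl_energy_bound:
  fixes x :: "nat \<Rightarrow> real"
  assumes "\<And>N. N \<ge> 2 \<Longrightarrow>
      (\<Sum>n = 1..N - 1. \<Sum>k = 1..N. cos (2 * pi * real k * (x N - x n)) / real k) \<le> 0"
  shows "\<exists>B N0. 0 < B \<and> 2 \<le> N0 \<and> (\<forall>N\<ge>N0. \<forall>M.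
    (\<Sum>k<M. (1 - 1 / real N) ^ Suc k / real (Suc k) * (cmod (weyl x N (Suc k)))\<^sup>2)
      \<le> B * (real N * ln (real N)))"
proof -
  define c :: real where "c = exp 12803"
  define N0 where "N0 = nat \<lceil>c\<rceil>"
  define A where "A = real N0 + 2 * (4 * c + 1)"
  define q where "q = sqrt (1 / (1 + c))"
  have c: "12804 \<le> c" using exp_ge_add_one_self[of 12803] by (simp add: c_def)
  have N0: "c \<le> real N0" unfolding N0_def by linarith
  have q: "0 < q" using c by (simp add: q_def)
  have "(\<Sum>k<M. (1 - 1 / real N) ^ Suc k / real (Suc k) * (cmod (weyl x N (Suc k)))\<^sup>2)
      \<le> A / q * (real N * ln (real N))" if N: "N0 \<le> N" for N M
  proof -
    have N': "1 < real N" using N N0 c by linarith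
    have "\<forall>\<^sub>F M' in sequentially. energy c x M' N \<le> A * real N * ln (real N)"
      by (rule eventually_energy_le[OF assms _ N0 _ _ N]) (use c in \<open>auto simp: A_def c_def\<close>)
    then have "\<forall>\<^sub>F M' in sequentially. M \<le> M' \<and> energy c x M' N \<le> A * real N * ln (real N)"
      using eventually_ge_at_top by (rule eventually_conj[rotated])
    then obtain M' where M': "M \<le> M'" "energy c x M' N \<le> A * real N * ln (real N)"
      using eventually_happens'[OF sequentially_bot] by blast
    have "q * (\<Sum>k<M. (1 - 1 / real N) ^ Suc k / real (Suc k) * (cmod (weyl x N (Suc k)))\<^sup>2)
        \<le> energy c x M N"
      unfolding energy_def sum_distrib_left mult.assoc[symmetric]
    proof (intro sum_mono mult_right_mono)
      fix k
      show "q * ((1 - 1 / real N) ^ Suc k / real (Suc k)) \<le> coef (c / real N) k"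
        using coef_ge[of c "1 / real N" k] c N' by (simp add: q_def)
    qed simp
    also have "\<dots> \<le> A * real N * ln (real N)"
      using energy_mono[of c N M M' x] M' c N' by simp
    finally show ?thesis using q by (simp add: field_simps)
  qed
  moreover have "0 < A / q" "2 \<le> N0" using q c N0 by (auto simp: A_def)
  ultimately show ?thesis by blast
qed

section \<open>From energy to discrepancy\<close>

text \<open>The usual Poisson kernel (1 - r^2) / (1 - 2 r cos \<theta> + r^2) at r =
  \<open>radius m\<close>, in half angles.\<close>

definition poisson_kernel :: "real \<Rightarrow> real \<Rightarrow> real" where
  "poisson_kernel m \<theta> = m / ((sin (\<theta> / 2))\<^sup>2 + m\<^sup>2 * (cos (\<theta> / 2))\<^sup>2)"

text \<open>On 0 < \<theta> < 2 pi this is the sum of r^k sin (k \<theta>) / k with r =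
  \<open>radius m\<close>. In the parameter m the argument of arctan is linear, which the later
  extrapolation relies on.\<close>

definition smooth_saw :: "real \<Rightarrow> real \<Rightarrow> real" where
  "smooth_saw m \<theta> = (pi - \<theta>) / 2 - arctan (m * (cos (\<theta> / 2) / sin (\<theta> / 2)))"

definition radius :: "real \<Rightarrow> real" where
  "radius m = (1 - m) / (1 + m)"

lemma radius_bounds:
  assumes "0 < m" "m \<le> 1"
  shows "0 \<le> radius m" "radius m < 1"
  using assms by (auto simp: radius_def)

lemma poisson_kernel_den_pos:
  fixes m x :: real
  assumes "0 < m"
  shows "0 < (sin x)\<^sup>2 + m\<^sup>2 * (cos x)\<^sup>2"
proof (cases "sin x = 0")
  case True
  then have "(cos x)\<^sup>2 = 1" using sin_cos_squared_add[of x] by simp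
  then show ?thesis using True assms by simp
qed (use assms in \<open>auto intro!: add_pos_nonneg\<close>)

lemma poisson_kernel_eq:
  assumes "0 < m"
  shows "radius m * ((cos \<theta> - radius m) / poisson_den (radius m) \<theta>) = (poisson_kernel m \<theta> - 1) / 2"
proof -
  define s where "s = (sin (\<theta> / 2))\<^sup>2"
  define q where "q = s + m\<^sup>2 * (1 - s)"
  have c2: "(cos (\<theta> / 2))\<^sup>2 = 1 - s" by (simp add: s_def cos_squared_eq)
  have q0: "0 < q" using poisson_kernel_den_pos[OF assms, of "\<theta> / 2"] by (simp add: q_def c2 s_def)
  have c: "cos \<theta> = 1 - 2 * s" unfolding s_def by (rule cos_eq_sin_half)
  have rm: "radius m * (1 + m) = 1 - m" using assms by (simp add: radius_def)
  have "poisson_den (radius m) \<theta> * (1 + m)\<^sup>2 = 4 * q"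
    unfolding poisson_den_def c q_def using rm by algebra
  then have D: "poisson_den (radius m) \<theta> = 4 * q / (1 + m)\<^sup>2"
    using assms by (simp add: eq_divide_eq)
  have "radius m * (cos \<theta> - radius m) * (1 + m)\<^sup>2 = 2 * (m - q)"
    unfolding c q_def using rm by algebra
  then have n: "radius m * (cos \<theta> - radius m) = 2 * (m - q) / (1 + m)\<^sup>2"
    using assms by (simp add: eq_divide_eq)
  have "radius m * ((cos \<theta> - radius m) / poisson_den (radius m) \<theta>)
      = 2 * (m - q) / (1 + m)\<^sup>2 / (4 * q / (1 + m)\<^sup>2)"
    unfolding D n[symmetric] by simp
  also have "\<dots> = (m - q) / (2 * q)"
  proof -
    have "2 * X / K / (4 * q / K) = X / (2 * q)" if "K \<noteq> 0" for X K :: real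
      using q0 that by (simp add: divide_simps)
    note this[of "(1 + m)\<^sup>2" "m - q"]
    moreover have "(1 + m)\<^sup>2 \<noteq> 0" using assms by simp
    ultimately show ?thesis by blast
  qed
  also have "\<dots> = (m / q - 1) / 2" using q0 by (simp add: field_simps)
  finally show ?thesis unfolding poisson_kernel_def c2 by (simp add: q_def s_def)
qed

text \<open>The denominator is at least (1 - r)^2, so the error is uniform in \<theta>; this permits
  integration of the series.\<close>

lemma poisson_partial_sum:
  assumes m: "0 < m" "m \<le> 1"
  shows "\<bar>(\<Sum>k<M. radius m ^ Suc k * cos (real (Suc k) * \<theta>)) - (poisson_kernel m \<theta> - 1) / 2\<bar>
    \<le> radius m ^ Suc M / (1 - radius m)"
proof -
  define r where "r = radius m"
  have r: "0 \<le> r" "r < 1" using radius_bounds[OF m] by (simp_all add: r_def)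
  have g: "(1 - r)\<^sup>2 \<le> poisson_den r \<theta>" by (rule poisson_den_ge_gap[OF r(1)])
  then have D0: "0 < poisson_den r \<theta>" using r by (smt (verit) zero_less_power)
  have "(\<Sum>k<M. r ^ Suc k * cos (real (Suc k) * \<theta>)) - (poisson_kernel m \<theta> - 1) / 2
      = r * ((\<Sum>k<M. r ^ k * cos (real (Suc k) * \<theta>)) - (cos \<theta> - r) / poisson_den r \<theta>)"
    unfolding poisson_kernel_eq[OF m(1), symmetric] r_def[symmetric]
    by (simp add: right_diff_distrib sum_distrib_left mult.assoc)
  then have "\<bar>(\<Sum>k<M. r ^ Suc k * cos (real (Suc k) * \<theta>)) - (poisson_kernel m \<theta> - 1) / 2\<bar>
      = r * \<bar>(\<Sum>k<M. r ^ k * cos (real (Suc k) * \<theta>)) - (cos \<theta> - r) / poisson_den r \<theta>\<bar>"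
    using r by (simp add: abs_mult)
  also have "\<dots> \<le> r * (r ^ M / sqrt (poisson_den r \<theta>))"
    by (intro mult_left_mono cos_power_sum_approx r D0)
  also have "\<dots> \<le> r * (r ^ M / (1 - r))"
    using r g D0 by (intro mult_left_mono divide_left_mono real_le_rsqrt mult_pos_pos) auto
  finally show ?thesis by (simp add: r_def)
qed

lemma radius_power_tendsto_0:
  assumes "0 < m" "m \<le> 1"
  shows "(\<lambda>M. C * (radius m ^ Suc M / (1 - radius m))) \<longlonglongrightarrow> 0"
proof -
  have "(\<lambda>M. radius m ^ Suc M) \<longlonglongrightarrow> 0"
    using radius_bounds[OF assms] by (intro LIMSEQ_Suc LIMSEQ_power_zero) auto
  from tendsto_mult_right_zero[OF tendsto_divide_zero[OF this]] show ?thesis .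
qed

lemma poisson_kernel_sums:
  assumes m: "0 < m" "m \<le> 1"
  shows "(\<lambda>k. radius m ^ Suc k * cos (real (Suc k) * \<theta>)) sums ((poisson_kernel m \<theta> - 1) / 2)"
  unfolding sums_def
proof (rule LIM_zero_cancel, rule tendsto_rabs_zero_cancel, rule tendsto_sandwich[OF _ _ tendsto_const])
  show "(\<lambda>M. 1 * (radius m ^ Suc M / (1 - radius m))) \<longlonglongrightarrow> 0" by (rule radius_power_tendsto_0[OF m])
qed (use poisson_partial_sum[OF m] in auto)

lemma smooth_saw_has_derivative:
  assumes "0 < m" "0 < \<theta>" "\<theta> < 2 * pi"
  shows "(smooth_saw m has_real_derivative (poisson_kernel m \<theta> - 1) / 2) (at \<theta>)"
proof -
  define s c where "s = sin (\<theta> / 2)" "c = cos (\<theta> / 2)"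
  have s: "0 < s" unfolding s_c_def using assms by (intro sin_gt_zero) auto
  have p: "s\<^sup>2 + c\<^sup>2 = 1" by (simp add: s_c_def)
  have d: "0 < s\<^sup>2 + m\<^sup>2 * c\<^sup>2" using poisson_kernel_den_pos[OF assms(1), of "\<theta> / 2"] by (simp add: s_c_def)
  have der: "(smooth_saw m has_real_derivative
      - 1 / 2 - inverse (1 + (m * (c / s))\<^sup>2) * (m * (((- s / 2) * s - c * (c / 2)) / (s * s)))) (at \<theta>)"
  proof -
    have "((\<lambda>\<theta>. cos (\<theta> / 2) / sin (\<theta> / 2)) has_real_derivative
        ((- s / 2) * s - c * (c / 2)) / (s * s)) (at \<theta>)"
      unfolding s_c_def using s[unfolded s_c_def] by (auto intro!: derivative_eq_intros)
    from DERIV_chain2[OF DERIV_arctan DERIV_cmult[OF this, of m]]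
    have "((\<lambda>\<theta>. arctan (m * (cos (\<theta> / 2) / sin (\<theta> / 2)))) has_real_derivative
        inverse (1 + (m * (c / s))\<^sup>2) * (m * (((- s / 2) * s - c * (c / 2)) / (s * s)))) (at \<theta>)"
      by (simp add: s_c_def)
    moreover have "((\<lambda>\<theta>. (pi - \<theta>) / 2) has_real_derivative - 1 / 2) (at \<theta>)"
      by (auto intro!: derivative_eq_intros)
    ultimately show ?thesis unfolding smooth_saw_def by (rule DERIV_diff[rotated])
  qed
  have i1: "((- s / 2) * s - c * (c / 2)) / (s * s) = - (1 / (2 * s\<^sup>2))"
  proof -
    have "(- s / 2) * s - c * (c / 2) = - (s\<^sup>2 + c\<^sup>2) / 2" by (simp add: power2_eq_square field_simps)
    then show ?thesis unfolding p by (simp add: power2_eq_square)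
  qed
  have i2: "inverse (1 + (m * (c / s))\<^sup>2) = s\<^sup>2 / (s\<^sup>2 + m\<^sup>2 * c\<^sup>2)"
  proof -
    have "1 + (m * (c / s))\<^sup>2 = (s\<^sup>2 + m\<^sup>2 * c\<^sup>2) / s\<^sup>2"
      using s by (simp add: power_mult_distrib power_divide add_divide_distrib)
    then show ?thesis by simp
  qed
  have i3: "- 1 / 2 - s\<^sup>2 / (s\<^sup>2 + m\<^sup>2 * c\<^sup>2) * (m * - (1 / (2 * s\<^sup>2))) = (m / (s\<^sup>2 + m\<^sup>2 * c\<^sup>2) - 1) / 2"
    using s d by (simp add: diff_divide_distrib)
  from der show ?thesis unfolding i1 i2 i3 by (simp only: poisson_kernel_def s_c_def)
qed

text \<open>The partial sums and the limit both vanish at pi, and their derivatives are uniformly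
  close; the mean value inequality carries this closeness from pi to \<theta>.\<close>

lemma smooth_saw_sums:
  assumes m: "0 < m" "m \<le> 1" and \<theta>: "0 < \<theta>" "\<theta> < 2 * pi"
  shows "(\<lambda>k. radius m ^ Suc k / real (Suc k) * sin (real (Suc k) * \<theta>)) sums smooth_saw m \<theta>"
  unfolding sums_def
proof (rule LIM_zero_cancel, rule tendsto_rabs_zero_cancel, rule tendsto_sandwich[OF _ _ tendsto_const])
  show "(\<lambda>M. \<bar>\<theta> - pi\<bar> * (radius m ^ Suc M / (1 - radius m))) \<longlonglongrightarrow> 0"
    by (rule radius_power_tendsto_0[OF m])
  have "\<bar>(\<Sum>k<M. radius m ^ Suc k / real (Suc k) * sin (real (Suc k) * \<theta>)) - smooth_saw m \<theta>\<bar>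
      \<le> radius m ^ Suc M / (1 - radius m) * \<bar>\<theta> - pi\<bar>" for M
  proof -
    define g where "g z = (\<Sum>k<M. radius m ^ Suc k / real (Suc k) * sin (real (Suc k) * z)) - smooth_saw m z" for z
    have "norm (g \<theta> - g pi) \<le> radius m ^ Suc M / (1 - radius m) * norm (\<theta> - pi)"
    proof (rule field_differentiable_bound[of "{0<..<2 * pi}"])
      fix z assume z: "z \<in> {0<..<2 * pi}"
      have "(g has_real_derivative (\<Sum>k<M. radius m ^ Suc k / real (Suc k) * (cos (real (Suc k) * z) * real (Suc k)))
          - (poisson_kernel m z - 1) / 2) (at z)"
        unfolding g_def using z m
        by (intro DERIV_diff DERIV_sum DERIV_cmult smooth_saw_has_derivative) (auto intro!: derivative_eq_intros)
      also have "(\<Sum>k<M. radius m ^ Suc k / real (Suc k) * (cos (real (Suc k) * z) * real (Suc k)))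
          = (\<Sum>k<M. radius m ^ Suc k * cos (real (Suc k) * z))"
        by (intro sum.cong) auto
      finally show "(g has_real_derivative (\<Sum>k<M. radius m ^ Suc k * cos (real (Suc k) * z))
          - (poisson_kernel m z - 1) / 2) (at z within {0<..<2 * pi})"
        by (rule DERIV_subset) simp
      show "norm ((\<Sum>k<M. radius m ^ Suc k * cos (real (Suc k) * z)) - (poisson_kernel m z - 1) / 2)
          \<le> radius m ^ Suc M / (1 - radius m)"
        using poisson_partial_sum[OF m] by simp
    qed (use \<theta> in auto)
    moreover have "g pi = 0"
    proof -
      have "sin (real (Suc k) * pi) = 0" for k by (rule sin_npi)
      then show ?thesis unfolding g_def smooth_saw_def by simp
    qed
    ultimately show ?thesis by (simp add: g_def)
  qed
  then show "\<forall>\<^sub>F M in sequentially. \<bar>(\<Sum>k<M. radius m ^ Suc k / real (Suc k) * sin (real (Suc k) * \<theta>)) - smooth_saw m \<theta>\<bar>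
      \<le> \<bar>\<theta> - pi\<bar> * (radius m ^ Suc M / (1 - radius m))"
    by (simp add: mult.commute)
qed auto

section \<open>Third-order approximation of the sawtooth\<close>

text \<open>The linear terms cancel: the derivative is at most 6 u^2, so the difference is at most 2
  u^3 for 0 \<le> u \<le> 1. For u > 1 it is at most pi while the right side is at least 7/2, whence
  the constant 7.\<close>

lemma arctan_richardson:
  "\<bar>2 * arctan u - arctan (2 * u)\<bar> \<le> 7 * (u\<^sup>2 / (1 + u\<^sup>2))"
proof -
  have main: "\<bar>2 * arctan u - arctan (2 * u)\<bar> \<le> 7 * (u\<^sup>2 / (1 + u\<^sup>2))" if u: "0 \<le> u" for u :: real
  proof (cases "u \<le> 1")
    case True
    define g where "g z = 2 * arctan z - arctan (2 * z)" for z :: real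
    define g' where "g' z = 6 * z\<^sup>2 / ((1 + z\<^sup>2) * (1 + 4 * z\<^sup>2))" for z :: real
    have g': "(g has_real_derivative g' z) (at z)" for z
    proof -
      have "0 < 1 + z\<^sup>2" "0 < 1 + 4 * z\<^sup>2" by (simp_all add: add_pos_nonneg)
      then have "2 * inverse (1 + z\<^sup>2) - inverse (1 + (2 * z)\<^sup>2) * 2 = g' z"
        unfolding g'_def by (simp add: power_mult_distrib divide_simps)
      moreover have "(g has_real_derivative 2 * inverse (1 + z\<^sup>2) - inverse (1 + (2 * z)\<^sup>2) * 2) (at z)"
        unfolding g_def by (auto intro!: derivative_eq_intros)
      ultimately show ?thesis by simp
    qed
    have g'b: "0 \<le> g' z" "g' z \<le> 6 * z\<^sup>2" for z
    proof -
      show "0 \<le> g' z" by (simp add: g'_def)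
      have "1 \<le> (1 + z\<^sup>2) * (1 + 4 * z\<^sup>2)" by (simp add: algebra_simps)
      then show "g' z \<le> 6 * z\<^sup>2" unfolding g'_def
        using divide_left_mono[of 1 "(1 + z\<^sup>2) * (1 + 4 * z\<^sup>2)" "6 * z\<^sup>2"] by simp
    qed
    have "g 0 \<le> g u" using u by (rule DERIV_nonneg_imp_nondecreasing) (use g' g'b in blast)
    moreover have "2 * 0 ^ 3 - g 0 \<le> 2 * u ^ 3 - g u"
      using u by (rule DERIV_nonneg_imp_nondecreasing)
        (use g' g'b in \<open>auto intro!: exI derivative_eq_intros\<close>)
    moreover have "2 * u ^ 3 \<le> 7 * (u\<^sup>2 / (1 + u\<^sup>2))"
    proof -
      have p: "0 < 1 + u\<^sup>2" by (simp add: add_pos_nonneg)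
      have "u * (1 + u\<^sup>2) \<le> 1 * (1 + 1)"
        using u True by (intro mult_mono add_mono power_le_one) auto
      then have "u\<^sup>2 * (2 * (u * (1 + u\<^sup>2))) \<le> u\<^sup>2 * 7" by (intro mult_left_mono) auto
      then have "2 * u ^ 3 * (1 + u\<^sup>2) \<le> 7 * u\<^sup>2" by (simp add: power3_eq_cube power2_eq_square mult_ac)
      then have "2 * u ^ 3 \<le> 7 * u\<^sup>2 / (1 + u\<^sup>2)" using p by (simp add: pos_le_divide_eq)
      then show ?thesis by simp
    qed
    ultimately show ?thesis by (simp add: g_def)
  next
    case False
    then have "1 \<le> u\<^sup>2" by simp
    then have h: "1 / 2 \<le> u\<^sup>2 / (1 + u\<^sup>2)" by (simp add: divide_simps)
    have "0 \<le> arctan u" "0 \<le> arctan (2 * u)" using u by simp_all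
    moreover have "arctan u < pi / 2" "arctan (2 * u) < pi / 2" by (rule arctan_ubound)+
    ultimately have "\<bar>2 * arctan u - arctan (2 * u)\<bar> \<le> pi" by linarith
    also have "pi \<le> 7 * (1 / 2)" using pi_less_4 pi_approx by simp
    finally show ?thesis using h by linarith
  qed
  show ?thesis
  proof (cases "0 \<le> u")
    case False
    then show ?thesis using main[of "- u"] by (simp add: arctan_minus abs_minus_commute)
  qed (rule main)
qed

text \<open>
  Richardson extrapolation of \<open>smooth_saw\<close> in \<open>m\<close>: a single \<open>smooth_saw m\<close> differs from the sawtooth by about
  \<open>m / \<theta>\<close>, which no multiple of \<open>m * poisson_kernel m\<close> dominates, whereas the error of the combination
  \<open>2 * smooth_saw m - smooth_saw (2 * m)\<close> is of third order.
\<close>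

definition saw_coef :: "real \<Rightarrow> nat \<Rightarrow> real" where
  "saw_coef m k = (2 * radius m ^ Suc k - radius (2 * m) ^ Suc k) / real (Suc k)"

text \<open>The subtracted power has the smaller radius; m \<le> 1/2 keeps that radius
  non-negative.\<close>

lemma saw_coef_bounds:
  assumes "0 < m" "m \<le> 1 / 2"
  shows "0 \<le> saw_coef m k" "saw_coef m k \<le> 2 * (radius m ^ Suc k / real (Suc k))"
proof -
  have r: "0 \<le> radius (2 * m)" "0 \<le> radius m" "radius (2 * m) \<le> radius m"
    using assms by (auto simp: radius_def intro!: frac_le)
  then have "radius (2 * m) ^ Suc k \<le> radius m ^ Suc k" "0 \<le> radius (2 * m) ^ Suc k" "0 \<le> radius m ^ Suc k"
    by (auto intro!: power_mono simp del: power_Suc)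
  then show "0 \<le> saw_coef m k" "saw_coef m k \<le> 2 * (radius m ^ Suc k / real (Suc k))"
    unfolding saw_coef_def by (auto intro!: divide_nonneg_pos divide_right_mono simp del: power_Suc)
qed

text \<open>At \<open>y = 0\<close> either sign \<open>\<sigma>\<close> is allowed, because there \<open>m * poisson_kernel m 0 = 1\<close>.\<close>

lemma saw_sums_error:
  assumes m: "0 < m" "m \<le> 1 / 2" and y: "\<bar>y\<bar> \<le> 1"
    and \<sigma>: "\<bar>\<sigma>\<bar> = 1" "y > 0 \<Longrightarrow> \<sigma> = 1" "y < 0 \<Longrightarrow> \<sigma> = -1"
  shows "\<exists>T. (\<lambda>k. saw_coef m k * sin (real (Suc k) * (2 * pi * y))) sums T \<and>
    \<bar>T / pi - (\<sigma> / 2 - y)\<bar> \<le> 3 * (m * poisson_kernel m (2 * pi * y))"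
proof -
  have pos: "\<exists>T. (\<lambda>k. saw_coef m k * sin (real (Suc k) * (2 * pi * y))) sums T \<and>
    \<bar>T / pi - (1 / 2 - y)\<bar> \<le> 3 * (m * poisson_kernel m (2 * pi * y))" if y: "0 < y" "y < 1" for y
  proof -
    define \<theta> where "\<theta> = 2 * pi * y"
    have \<theta>: "0 < \<theta>" "\<theta> < 2 * pi" using y by (auto simp: \<theta>_def)
    define s c where "s = sin (\<theta> / 2)" "c = cos (\<theta> / 2)"
    have s: "0 < s" unfolding s_c_def using \<theta> by (intro sin_gt_zero) auto
    \<comment> \<open>This is m cot (\<theta> / 2), the argument of arctan in
      \<open>smooth_saw m\<close>; u^2 / (1 + u^2) is cos^2 (\<theta> / 2) times
      \<open>m * poisson_kernel m \<theta>\<close>.\<close>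
    define u where "u = m * (c / s)"
    define T where "T = 2 * smooth_saw m \<theta> - smooth_saw (2 * m) \<theta>"
    have "(\<lambda>k. 2 * (radius m ^ Suc k / real (Suc k) * sin (real (Suc k) * \<theta>))
        - radius (2 * m) ^ Suc k / real (Suc k) * sin (real (Suc k) * \<theta>)) sums T"
      unfolding T_def using m \<theta> by (intro sums_diff sums_mult smooth_saw_sums) auto
    then have sums: "(\<lambda>k. saw_coef m k * sin (real (Suc k) * \<theta>)) sums T"
      unfolding saw_coef_def by (simp only: diff_divide_distrib left_diff_distrib mult.assoc times_divide_eq_right[symmetric])
    have "T = (pi - \<theta>) / 2 - (2 * arctan u - arctan (2 * u))"
      unfolding T_def smooth_saw_def u_def s_c_def by (simp add: mult.assoc diff_divide_distrib)
    also have "(pi - \<theta>) / 2 = pi * (1 / 2 - y)" by (simp add: \<theta>_def field_simps)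
    finally have "T / pi - (1 / 2 - y) = - (2 * arctan u - arctan (2 * u)) / pi"
      by (simp add: diff_divide_distrib)
    then have "\<bar>T / pi - (1 / 2 - y)\<bar> = \<bar>2 * arctan u - arctan (2 * u)\<bar> / pi"
      by (simp only: abs_divide abs_minus_cancel) simp
    also have "\<dots> \<le> 7 * (u\<^sup>2 / (1 + u\<^sup>2)) / pi"
      by (intro divide_right_mono arctan_richardson) simp
    also have "\<dots> \<le> 7 * (u\<^sup>2 / (1 + u\<^sup>2)) / (7 / 3)"
      using pi_gt3 by (intro divide_left_mono) auto
    also have "\<dots> = 3 * (u\<^sup>2 / (1 + u\<^sup>2))"
    proof -
      have "7 * v / (7 / 3) = 3 * v" for v :: real by simp
      then show ?thesis .
    qed
    also have "u\<^sup>2 / (1 + u\<^sup>2) \<le> m * poisson_kernel m \<theta>"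
    proof -
      have "u\<^sup>2 / (1 + u\<^sup>2) = (s\<^sup>2 * u\<^sup>2) / (s\<^sup>2 * (1 + u\<^sup>2))" using s by simp
      also have "s\<^sup>2 * u\<^sup>2 = m\<^sup>2 * c\<^sup>2" using s by (simp add: u_def power_mult_distrib power_divide)
      also have "s\<^sup>2 * (1 + u\<^sup>2) = s\<^sup>2 + m\<^sup>2 * c\<^sup>2"
        using s by (simp add: u_def power_mult_distrib power_divide distrib_left)
      also have "m\<^sup>2 * c\<^sup>2 / (s\<^sup>2 + m\<^sup>2 * c\<^sup>2) \<le> m\<^sup>2 * 1 / (s\<^sup>2 + m\<^sup>2 * c\<^sup>2)"
        by (intro divide_right_mono mult_left_mono) (auto simp: s_c_def abs_square_le_1)
      also have "\<dots> = m * poisson_kernel m \<theta>" by (simp add: poisson_kernel_def s_c_def power2_eq_square)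
      finally show ?thesis .
    qed
    finally show ?thesis using sums unfolding \<theta>_def by auto
  qed
  \<comment> \<open>Negative y follow by oddness. At -1, 0 and 1 the series vanishes, and the
    allowed error 3 exceeds the jump value.\<close>
  consider "0 < y" "y < 1" | "-1 < y" "y < 0" | "y \<in> {-1, 0, 1}" using y by fastforce
  then show ?thesis
  proof cases
    case 1
    then show ?thesis using pos[OF 1] \<sigma> by simp
  next
    case 2
    obtain T where T: "(\<lambda>k. saw_coef m k * sin (real (Suc k) * (2 * pi * - y))) sums T"
      "\<bar>T / pi - (1 / 2 - - y)\<bar> \<le> 3 * (m * poisson_kernel m (2 * pi * - y))"
      using pos[of "- y"] 2 by auto
    have "(\<lambda>k. saw_coef m k * sin (real (Suc k) * (2 * pi * y))) sums (- T)"
      using sums_minus[OF T(1)] by simp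
    moreover have "\<bar>- T / pi - (\<sigma> / 2 - y)\<bar> \<le> 3 * (m * poisson_kernel m (2 * pi * y))"
    proof -
      have "- T / pi - (\<sigma> / 2 - y) = - (T / pi - (1 / 2 - - y))" using \<sigma> 2 by simp
      then have "\<bar>- T / pi - (\<sigma> / 2 - y)\<bar> = \<bar>T / pi - (1 / 2 - - y)\<bar>" by (simp only: abs_minus_cancel)
      then show ?thesis using T(2) by (simp add: poisson_kernel_def)
    qed
    ultimately show ?thesis by blast
  next
    case 3
    have s0: "sin (real (Suc k) * (2 * pi * y)) = 0" for k
    proof -
      have "sin (real (2 * Suc k) * pi) = 0" by (rule sin_npi)
      moreover have "real (2 * Suc k) * pi = real (Suc k) * (2 * pi)" by simp
      ultimately have "sin (real (Suc k) * (2 * pi)) = 0" by metis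
      then show ?thesis using 3 by (elim insertE) (simp_all only: mult_1_right mult_minus_right sin_minus, auto)
    qed
    have "m * poisson_kernel m (2 * pi * y) = 1"
      using 3 m by (auto simp: poisson_kernel_def power2_eq_square)
    moreover have "\<bar>0 / pi - (\<sigma> / 2 - y)\<bar> \<le> 3" using \<sigma>(1) y by (auto simp: abs_if split: if_splits)
    ultimately show ?thesis unfolding s0 by (intro exI[of _ 0]) simp
  qed
qed

section \<open>From exponential sums to counting points\<close>

text \<open>Translation by t multiplies the exponential sum by a number of modulus 1.\<close>

lemma weyl_shift:
  "\<bar>\<Sum>i = 1..N. sin (2 * pi * real j * (x i - t))\<bar> \<le> cmod (weyl x N j)"
  "\<bar>\<Sum>i = 1..N. cos (2 * pi * real j * (x i - t))\<bar> \<le> cmod (weyl x N j)"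
proof -
  define z where "z = cis (- (2 * pi * real j * t)) * weyl x N j"
  have z: "z = (\<Sum>i = 1..N. cis (2 * pi * real j * (x i - t)))"
    unfolding z_def weyl_def sum_distrib_left cis_mult by (simp add: algebra_simps)
  have "cmod z = cmod (weyl x N j)" by (simp add: z_def norm_mult)
  moreover have "Im z = (\<Sum>i = 1..N. sin (2 * pi * real j * (x i - t)))"
    "Re z = (\<Sum>i = 1..N. cos (2 * pi * real j * (x i - t)))" unfolding z by simp_all
  ultimately show "\<bar>\<Sum>i = 1..N. sin (2 * pi * real j * (x i - t))\<bar> \<le> cmod (weyl x N j)"
    "\<bar>\<Sum>i = 1..N. cos (2 * pi * real j * (x i - t))\<bar> \<le> cmod (weyl x N j)"
    using abs_Im_le_cmod[of z] abs_Re_le_cmod[of z] by simp_all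
qed

text \<open>The function f is left open so that the sine series of the sawtooth and the cosine
  series of the Poisson kernel share one argument.\<close>

lemma weyl_series_bound:
  fixes f :: "nat \<Rightarrow> real \<Rightarrow> real"
  assumes f: "\<And>j. \<bar>\<Sum>i = 1..N. f j (x i - t)\<bar> \<le> cmod (weyl x N j)"
    and T: "\<And>i. i \<in> {1..N} \<Longrightarrow> (\<lambda>k. b k * f (Suc k) (x i - t)) sums T i"
    and b: "\<And>k. 0 \<le> b k"
    and W: "\<And>K. (\<Sum>k<K. b k * cmod (weyl x N (Suc k))) \<le> W"
  shows "\<bar>\<Sum>i = 1..N. T i\<bar> \<le> W"
proof -
  have "(\<lambda>k. \<Sum>i = 1..N. b k * f (Suc k) (x i - t)) sums (\<Sum>i = 1..N. T i)"
    by (rule sums_sum) (rule T)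
  then have "(\<lambda>K. \<bar>\<Sum>k<K. \<Sum>i = 1..N. b k * f (Suc k) (x i - t)\<bar>) \<longlonglongrightarrow> \<bar>\<Sum>i = 1..N. T i\<bar>"
    unfolding sums_def by (rule tendsto_rabs)
  then show ?thesis
  proof (rule LIMSEQ_le_const2, intro exI allI impI)
    fix K
    have "\<bar>\<Sum>k<K. \<Sum>i = 1..N. b k * f (Suc k) (x i - t)\<bar> \<le> (\<Sum>k<K. \<bar>\<Sum>i = 1..N. b k * f (Suc k) (x i - t)\<bar>)"
      by (rule sum_abs)
    also have "\<dots> \<le> (\<Sum>k<K. b k * cmod (weyl x N (Suc k)))"
    proof (rule sum_mono)
      fix k
      show "\<bar>\<Sum>i = 1..N. b k * f (Suc k) (x i - t)\<bar> \<le> b k * cmod (weyl x N (Suc k))"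
        unfolding sum_distrib_left[symmetric] using mult_left_mono[OF f b] b by (simp add: abs_mult)
    qed
    also have "\<dots> \<le> W" by (rule W)
    finally show "\<bar>\<Sum>k<K. \<Sum>i = 1..N. b k * f (Suc k) (x i - t)\<bar> \<le> W" .
  qed
qed

lemma weighted_Cauchy_Schwarz:
  fixes w d z :: "nat \<Rightarrow> real"
  assumes "\<And>k. 0 \<le> w k" "(\<Sum>k<K. w k * (d k)\<^sup>2) \<le> X" "(\<Sum>k<K. w k * (z k)\<^sup>2) \<le> Y"
  shows "(\<Sum>k<K. w k * d k * z k) \<le> sqrt (X * Y)"
proof (rule real_le_rsqrt)
  have sq: "sqrt (w k) * sqrt (w k) = w k" for k using assms(1)[of k] by simp
  have "(\<Sum>k<K. w k * d k * z k)\<^sup>2 = (\<Sum>k<K. (sqrt (w k) * d k) * (sqrt (w k) * z k))\<^sup>2"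
    by (intro arg_cong[where f = "\<lambda>u. u\<^sup>2"] sum.cong refl) (metis (no_types, lifting) sq mult.assoc mult.left_commute)
  also have "\<dots> \<le> (\<Sum>k<K. (sqrt (w k) * d k)\<^sup>2) * (\<Sum>k<K. (sqrt (w k) * z k)\<^sup>2)"
    by (rule Cauchy_Schwarz_ineq_sum)
  also have "\<dots> = (\<Sum>k<K. w k * (d k)\<^sup>2) * (\<Sum>k<K. w k * (z k)\<^sup>2)"
    by (simp add: power_mult_distrib assms(1))
  also have "\<dots> \<le> X * Y"
    by (intro mult_mono' assms sum_nonneg mult_nonneg_nonneg) auto
  finally show "(\<Sum>k<K. w k * d k * z k)\<^sup>2 \<le> X * Y" .
qed

text \<open>The centred indicator of [0, t] is a difference of sawtooths at x i and at x i - t. The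
  extrapolated series of each sums to at most 2 W1 over the points, and the approximation errors are
  two Poisson sums with m = 1 / N, each contributing at most 3 (1 + 2 W2).\<close>

lemma counting_error_le:
  fixes x :: "nat \<Rightarrow> real"
  assumes N: "2 \<le> N" and x: "\<And>i. i \<in> {1..N} \<Longrightarrow> x i \<in> {0..1}" and t: "t \<in> {0..1}"
    and W1: "\<And>K. (\<Sum>k<K. (1 - 1 / real N) ^ Suc k / real (Suc k) * cmod (weyl x N (Suc k))) \<le> W1"
    and W2: "\<And>K. 1 / real N * (\<Sum>k<K. (1 - 1 / real N) ^ Suc k * cmod (weyl x N (Suc k))) \<le> W2"
  shows "\<bar>real (card {i \<in> {1..N}. x i \<le> t}) - real N * t\<bar> \<le> 4 * W1 + 6 + 12 * W2"
proof -
  define m where "m = 1 / real N"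
  define q where "q = 1 - 1 / real N"
  have m: "0 < m" "m \<le> 1 / 2" "m \<le> 1" using N by (auto simp: m_def field_simps)
  have r: "0 \<le> radius m" using radius_bounds m by auto
  have angle: "real (Suc k) * (2 * pi * y) = 2 * pi * real (Suc k) * y" for k y
    by (simp only: mult_ac)
  \<comment> \<open>Since (1 - m) / (1 + m) \<le> 1 - m, the weights in the hypotheses dominate the
    Abel weights.\<close>
  have rq: "radius m ^ Suc k \<le> q ^ Suc k" for k
  proof -
    have "radius m \<le> q"
      using m divide_left_mono[of 1 "1 + m" "1 - m"] unfolding radius_def q_def m_def[symmetric] by simp
    then show ?thesis by (intro power_mono r)
  qed
  have P: "\<bar>\<Sum>i = 1..N. (poisson_kernel m (2 * pi * (x i - u)) - 1) / 2\<bar> \<le> real N * W2" for u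
  proof (rule weyl_series_bound[where f = "\<lambda>j y. cos (2 * pi * real j * y)" and t = u, OF weyl_shift(2)])
    show "(\<lambda>k. radius m ^ Suc k * cos (2 * pi * real (Suc k) * (x i - u))) sums
        ((poisson_kernel m (2 * pi * (x i - u)) - 1) / 2)" for i
      using poisson_kernel_sums[of m "2 * pi * (x i - u)"] m unfolding angle by simp
    show "0 \<le> radius m ^ Suc k" for k using r by simp
    fix K
    have "(\<Sum>k<K. radius m ^ Suc k * cmod (weyl x N (Suc k))) \<le> (\<Sum>k<K. q ^ Suc k * cmod (weyl x N (Suc k)))"
      by (intro sum_mono mult_right_mono rq) simp
    also have "\<dots> \<le> real N * W2"
      using W2[of K] N unfolding q_def[symmetric] by (simp add: field_simps)
    finally show "(\<Sum>k<K. radius m ^ Suc k * cmod (weyl x N (Suc k))) \<le> real N * W2" .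
  qed
  \<comment> \<open>The constant term of the kernel contributes m N = 1, the remaining frequencies
    at most 2 W2.\<close>
  have P': "m * (\<Sum>i = 1..N. poisson_kernel m (2 * pi * (x i - u))) \<le> 1 + 2 * W2" for u
  proof -
    have "(\<Sum>i = 1..N. (poisson_kernel m (2 * pi * (x i - u)) - 1) / 2)
        = ((\<Sum>i = 1..N. poisson_kernel m (2 * pi * (x i - u))) - real N) / 2"
      by (simp add: sum_subtractf flip: sum_divide_distrib)
    then have b: "\<bar>((\<Sum>i = 1..N. poisson_kernel m (2 * pi * (x i - u))) - real N) / 2\<bar> \<le> real N * W2"
      using P[of u] by (simp only:)
    have "(\<Sum>i = 1..N. poisson_kernel m (2 * pi * (x i - u))) \<le> real N + 2 * (real N * W2)"
      using abs_le_D1[OF b] by (simp add: field_simps)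
    then have "m * (\<Sum>i = 1..N. poisson_kernel m (2 * pi * (x i - u))) \<le> m * (real N + 2 * (real N * W2))"
      using m by (intro mult_left_mono) auto
    also have "\<dots> = 1 + 2 * W2" using N by (simp add: m_def distrib_left)
    finally show ?thesis .
  qed
  have saw: "\<exists>T. (\<forall>i\<in>{1..N}. \<bar>T i / pi - (\<sigma> i / 2 - (x i - u))\<bar> \<le> 3 * (m * poisson_kernel m (2 * pi * (x i - u))))
      \<and> \<bar>\<Sum>i = 1..N. T i\<bar> \<le> 2 * W1"
    if u: "u \<in> {0..1}" and \<sigma>: "\<And>i. i \<in> {1..N} \<Longrightarrow> \<bar>\<sigma> i\<bar> = 1 \<and> (x i > u \<longrightarrow> \<sigma> i = 1) \<and> (x i < u \<longrightarrow> \<sigma> i = -1)"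
    for u \<sigma>
  proof -
    have "\<forall>i\<in>{1..N}. \<exists>T. (\<lambda>k. saw_coef m k * sin (real (Suc k) * (2 * pi * (x i - u)))) sums T \<and>
        \<bar>T / pi - (\<sigma> i / 2 - (x i - u))\<bar> \<le> 3 * (m * poisson_kernel m (2 * pi * (x i - u)))"
    proof
      fix i assume i: "i \<in> {1..N}"
      show "\<exists>T. (\<lambda>k. saw_coef m k * sin (real (Suc k) * (2 * pi * (x i - u)))) sums T \<and>
        \<bar>T / pi - (\<sigma> i / 2 - (x i - u))\<bar> \<le> 3 * (m * poisson_kernel m (2 * pi * (x i - u)))"
        by (rule saw_sums_error) (use m x[OF i] u \<sigma>[OF i] in auto)
    qed
    from bchoice[OF this] obtain T where T: "\<And>i. i \<in> {1..N} \<Longrightarrow> (\<lambda>k. saw_coef m k * sin (real (Suc k) * (2 * pi * (x i - u)))) sums T i"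
      "\<And>i. i \<in> {1..N} \<Longrightarrow> \<bar>T i / pi - (\<sigma> i / 2 - (x i - u))\<bar> \<le> 3 * (m * poisson_kernel m (2 * pi * (x i - u)))"
      by blast
    have "\<bar>\<Sum>i = 1..N. T i\<bar> \<le> 2 * W1"
    proof (rule weyl_series_bound[where f = "\<lambda>j y. sin (2 * pi * real j * y)" and t = u, OF weyl_shift(1)])
      show "(\<lambda>k. saw_coef m k * sin (2 * pi * real (Suc k) * (x i - u))) sums T i" if "i \<in> {1..N}" for i
        using T(1)[OF that] unfolding angle .
      show "0 \<le> saw_coef m k" for k using saw_coef_bounds m by blast
      fix K
      have "(\<Sum>k<K. saw_coef m k * cmod (weyl x N (Suc k)))
          \<le> (\<Sum>k<K. 2 * (q ^ Suc k / real (Suc k) * cmod (weyl x N (Suc k))))"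
      proof (rule sum_mono)
        fix k
        have "saw_coef m k \<le> 2 * (radius m ^ Suc k / real (Suc k))" using saw_coef_bounds m by blast
        also have "\<dots> \<le> 2 * (q ^ Suc k / real (Suc k))"
          by (intro mult_left_mono divide_right_mono rq) auto
        finally have "saw_coef m k * cmod (weyl x N (Suc k)) \<le> 2 * (q ^ Suc k / real (Suc k)) * cmod (weyl x N (Suc k))"
          by (rule mult_right_mono) simp
        then show "saw_coef m k * cmod (weyl x N (Suc k)) \<le> 2 * (q ^ Suc k / real (Suc k) * cmod (weyl x N (Suc k)))"
          by (simp only: mult.assoc)
      qed
      also have "\<dots> \<le> 2 * W1" using W1[of K] unfolding q_def sum_distrib_left[symmetric] by simp
      finally show "(\<Sum>k<K. saw_coef m k * cmod (weyl x N (Suc k))) \<le> 2 * W1" .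
    qed
    with T(2) show ?thesis by blast
  qed
  \<comment> \<open>A point with x i = t gets the sign of the left side, because the count includes
    equality; for the sawtooth at 0 the sign is always 1.\<close>
  define \<sigma> where "\<sigma> i = (if x i \<le> t then -1 else 1 :: real)" for i
  obtain T0 where T0: "\<And>i. i \<in> {1..N} \<Longrightarrow> \<bar>T0 i / pi - (1 / 2 - (x i - 0))\<bar> \<le> 3 * (m * poisson_kernel m (2 * pi * (x i - 0)))"
    "\<bar>\<Sum>i = 1..N. T0 i\<bar> \<le> 2 * W1"
  proof -
    have z: "(0 :: real) \<in> {0..1}" by simp
    have "\<bar>1 :: real\<bar> = 1 \<and> (x i > 0 \<longrightarrow> 1 = (1 :: real)) \<and> (x i < 0 \<longrightarrow> 1 = (-1 :: real))"
      if "i \<in> {1..N}" for i using x[OF that] by simp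
    from saw[OF z this] show ?thesis using that by blast
  qed
  obtain Tt where Tt: "\<And>i. i \<in> {1..N} \<Longrightarrow> \<bar>Tt i / pi - (\<sigma> i / 2 - (x i - t))\<bar> \<le> 3 * (m * poisson_kernel m (2 * pi * (x i - t)))"
    "\<bar>\<Sum>i = 1..N. Tt i\<bar> \<le> 2 * W1"
  proof -
    have "\<bar>\<sigma> i\<bar> = 1 \<and> (x i > t \<longrightarrow> \<sigma> i = 1) \<and> (x i < t \<longrightarrow> \<sigma> i = -1)" for i
      by (simp add: \<sigma>_def)
    from saw[OF t this] show ?thesis using that by blast
  qed
  have "real (card {i \<in> {1..N}. x i \<le> t}) - real N * t = (\<Sum>i = 1..N. (if x i \<le> t then 1 else 0) - t)"
  proof -
    have "(\<Sum>i = 1..N. if x i \<le> t then 1 else 0 :: real) = (\<Sum>i\<in>{i \<in> {1..N}. x i \<le> t}. 1)"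
      by (rule sum.inter_filter[symmetric]) simp
    then show ?thesis by (simp add: sum_subtractf)
  qed
  \<comment> \<open>Both values 1 - t and -t of the centred indicator equal (1/2 - x i) - (\<sigma>
    i / 2 - (x i - t)).\<close>
  also have "\<dots> = (\<Sum>i = 1..N. ((1 / 2 - (x i - 0) - T0 i / pi) - (\<sigma> i / 2 - (x i - t) - Tt i / pi)) + (T0 i / pi - Tt i / pi))"
    by (intro sum.cong) (auto simp: \<sigma>_def)
  also have "\<dots> = (\<Sum>i = 1..N. (1 / 2 - (x i - 0) - T0 i / pi) - (\<sigma> i / 2 - (x i - t) - Tt i / pi))
      + ((\<Sum>i = 1..N. T0 i) / pi - (\<Sum>i = 1..N. Tt i) / pi)"
    by (simp only: sum.distrib sum_subtractf sum_divide_distrib)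
  finally have eq: "real (card {i \<in> {1..N}. x i \<le> t}) - real N * t = \<dots>" .
  have "\<bar>\<Sum>i = 1..N. (1 / 2 - (x i - 0) - T0 i / pi) - (\<sigma> i / 2 - (x i - t) - Tt i / pi)\<bar>
      \<le> (\<Sum>i = 1..N. 3 * (m * poisson_kernel m (2 * pi * (x i - 0))) + 3 * (m * poisson_kernel m (2 * pi * (x i - t))))"
  proof (rule order.trans[OF sum_abs sum_mono])
    fix i assume i: "i \<in> {1..N}"
    show "\<bar>(1 / 2 - (x i - 0) - T0 i / pi) - (\<sigma> i / 2 - (x i - t) - Tt i / pi)\<bar>
        \<le> 3 * (m * poisson_kernel m (2 * pi * (x i - 0))) + 3 * (m * poisson_kernel m (2 * pi * (x i - t)))"
      using T0(1)[OF i] Tt(1)[OF i] by linarith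
  qed
  also have "\<dots> = 3 * (m * (\<Sum>i = 1..N. poisson_kernel m (2 * pi * (x i - 0))))
      + 3 * (m * (\<Sum>i = 1..N. poisson_kernel m (2 * pi * (x i - t))))"
    by (simp only: sum.distrib sum_distrib_left)
  also have "\<dots> \<le> 3 * (1 + 2 * W2) + 3 * (1 + 2 * W2)"
    by (intro add_mono mult_left_mono P') auto
  finally have A: "\<bar>\<Sum>i = 1..N. (1 / 2 - (x i - 0) - T0 i / pi) - (\<sigma> i / 2 - (x i - t) - Tt i / pi)\<bar> \<le> 6 + 12 * W2"
    by simp
  have pi1: "\<bar>v / pi\<bar> \<le> \<bar>v\<bar>" for v
    using divide_left_mono[of 1 pi "\<bar>v\<bar>"] pi_gt3 by (simp add: abs_divide)
  show ?thesis
    unfolding eq using A pi1[of "\<Sum>i = 1..N. T0 i"] pi1[of "\<Sum>i = 1..N. Tt i"] T0(2) Tt(2) by linarith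
qed

section \<open>Cauchy-Schwarz and the discrepancy bound\<close>

text \<open>The coefficients of the minorant are reused with c = 1 and e = 1 / N: their sum is at
  most 3 + ln N \<le> 4 ln N, and the factor sqrt 2 lost in \<open>coef_ge\<close> is rounded up to
  2.\<close>

lemma sum_power_div_le:
  assumes "3 \<le> N"
  shows "(\<Sum>k<K. (1 - 1 / real N) ^ Suc k / real (Suc k)) \<le> 8 * ln (real N)"
proof -
  define S where "S = (\<Sum>k<K. (1 - 1 / real N) ^ Suc k / real (Suc k))"
  have l: "1 \<le> ln (real N)" using assms exp_le by (simp add: ln_ge_iff)
  have "sqrt (1 / (1 + 1)) * S \<le> (\<Sum>k<K. coef (1 * (1 / real N)) k)"
    unfolding S_def sum_distrib_left using assms by (intro sum_mono coef_ge) auto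
  also have "\<dots> \<le> 3 - ln (1 * (1 / real N))" using assms by (intro sum_coef_le) auto
  also have "\<dots> \<le> 4 * ln (real N)" using assms l by (simp add: ln_div)
  finally have 1: "sqrt (1 / (1 + 1)) * S \<le> 4 * ln (real N)" .
  have "0 \<le> S" unfolding S_def using assms by (intro sum_nonneg divide_nonneg_nonneg zero_le_power) auto
  moreover have "1 / 2 \<le> sqrt (1 / (1 + 1 :: real))" by (rule real_le_rsqrt) (simp add: power2_eq_square)
  ultimately have "1 / 2 * S \<le> sqrt (1 / (1 + 1)) * S" by (rule mult_right_mono[rotated])
  with 1 show ?thesis unfolding S_def by linarith
qed

lemma sum_Suc_power_le:
  assumes "0 \<le> q" "q < (1 :: real)"
  shows "(\<Sum>k<K. real (Suc k) * q ^ Suc k) \<le> 1 / (1 - q)\<^sup>2"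
proof -
  have "(\<lambda>k. of_nat (Suc k) * q ^ k) sums (1 / (1 - q)\<^sup>2)"
    using assms by (intro geometric_deriv_sums) simp
  then have "(\<Sum>k<K. real (Suc k) * q ^ k) \<le> 1 / (1 - q)\<^sup>2"
    unfolding sums_iff using assms sum_le_suminf[of "\<lambda>k. real (Suc k) * q ^ k" "{..<K}"] by auto
  moreover have "(\<Sum>k<K. real (Suc k) * q ^ Suc k) \<le> (\<Sum>k<K. real (Suc k) * q ^ k)"
    using assms by (intro sum_mono mult_left_mono) (auto intro: mult_left_le_one_le)
  ultimately show ?thesis by linarith
qed

lemma star_discrepancy_le:
  assumes "1 \<le> N" "\<And>t. t \<in> {0..1} \<Longrightarrow> \<bar>real (card {i \<in> {1..N}. x i \<le> t}) - real N * t\<bar> \<le> real N * B"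
  shows "star_discrepancy x N \<le> B"
  unfolding star_discrepancy_def
proof (rule cSUP_least)
  fix t :: real assume t: "t \<in> {0..1}"
  have "real N * \<bar>real (card {i \<in> {1..N}. x i \<le> t}) / real N - t\<bar>
      = \<bar>real N * (real (card {i \<in> {1..N}. x i \<le> t}) / real N - t)\<bar>" by (simp add: abs_mult)
  also have "\<dots> \<le> real N * B" using assms(2)[OF t] assms(1) by (simp add: right_diff_distrib)
  finally show "\<bar>real (card {i \<in> {1..N}. x i \<le> t}) / real N - t\<bar> \<le> B" using assms(1) by simp
qed simp

lemma star_discrepancy_le_1:
  assumes "1 \<le> N"
  shows "star_discrepancy x N \<le> 1"
proof (rule star_discrepancy_le[OF assms])
  fix t :: real assume t: "t \<in> {0..1}"
  have "card {i \<in> {1..N}. x i \<le> t} \<le> card {1..N}" by (intro card_mono) auto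
  then have "real (card {i \<in> {1..N}. x i \<le> t}) \<le> real N" by simp
  moreover have "0 \<le> real N * t" "real N * t \<le> real N" using t by (auto simp: mult_left_le)
  ultimately show "\<bar>real (card {i \<in> {1..N}. x i \<le> t}) - real N * t\<bar> \<le> real N * 1" by linarith
qed

text \<open>Two Cauchy-Schwarz estimates against the energy, with d = 1 for W1 and d = (k + 1) / N
  for W2. Both sums are then of order sqrt N ln N.\<close>

lemma star_discrepancy_le_energy:
  assumes N: "3 \<le> N" and x: "\<And>i. i \<in> {1..N} \<Longrightarrow> x i \<in> {0..1}" and B: "0 \<le> B"
    and E: "\<And>M. (\<Sum>k<M. (1 - 1 / real N) ^ Suc k / real (Suc k) * (cmod (weyl x N (Suc k)))\<^sup>2)
      \<le> B * (real N * ln (real N))"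
  shows "star_discrepancy x N \<le> (4 * sqrt (8 * B) + 6 + 12 * sqrt B) * (ln (real N) / sqrt (real N))"
proof (rule star_discrepancy_le)
  fix t :: real assume t: "t \<in> {0..1}"
  define L where "L = ln (real N)"
  define X where "X = sqrt (real N) * L"
  define q where "q = 1 - 1 / real N"
  define w where "w k = q ^ Suc k / real (Suc k)" for k
  define z where "z k = cmod (weyl x N (Suc k))" for k
  have L: "1 \<le> L" using N exp_le by (simp add: ln_ge_iff L_def)
  have q: "0 \<le> q" "q < 1" using N by (auto simp: q_def)
  have w: "0 \<le> w k" for k using q by (simp add: w_def)
  have E': "(\<Sum>k<K. w k * (z k)\<^sup>2) \<le> B * (real N * L)" for K
    using E[of K] by (simp add: w_def z_def q_def L_def)
  have W1: "(\<Sum>k<K. w k * z k) \<le> sqrt (8 * B) * X" for K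
  proof -
    have "(\<Sum>k<K. w k * 1\<^sup>2) \<le> 8 * L"
      using sum_power_div_le[OF N, of K] by (simp add: w_def q_def L_def)
    from weighted_Cauchy_Schwarz[OF w this E']
    have "(\<Sum>k<K. w k * z k) \<le> sqrt (8 * L * (B * (real N * L)))" by simp
    also have "8 * L * (B * (real N * L)) = 8 * B * (real N * L\<^sup>2)" by (simp add: power2_eq_square)
    also have "sqrt \<dots> = sqrt (8 * B) * X" using L by (simp add: X_def real_sqrt_mult)
    finally show ?thesis .
  qed
  have W2: "1 / real N * (\<Sum>k<K. q ^ Suc k * z k) \<le> sqrt B * X" for K
  proof -
    \<comment> \<open>One factor k + 1 cancels the denominator of the weight; the remaining sum is
      at most 1 / (1 - q)^2 = N^2.\<close>
    have "(\<Sum>k<K. w k * (real (Suc k) / real N)\<^sup>2) = (\<Sum>k<K. real (Suc k) * q ^ Suc k) * (1 / real N)\<^sup>2"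
      unfolding w_def sum_distrib_right
      by (intro sum.cong refl) (simp add: power2_eq_square field_simps del: of_nat_Suc power_Suc)
    also have "\<dots> \<le> 1 / (1 - q)\<^sup>2 * (1 / real N)\<^sup>2"
      by (intro mult_right_mono sum_Suc_power_le q) simp
    also have "\<dots> = 1" using N by (simp add: q_def power2_eq_square)
    finally have "(\<Sum>k<K. w k * (real (Suc k) / real N)\<^sup>2) \<le> 1" .
    from weighted_Cauchy_Schwarz[OF w this E']
    have "(\<Sum>k<K. w k * (real (Suc k) / real N) * z k) \<le> sqrt (B * (real N * L))" by simp
    also have "\<dots> \<le> sqrt (B * (real N * L\<^sup>2))"
      using L B by (intro real_sqrt_le_mono mult_left_mono) (auto simp: power2_eq_square)
    also have "\<dots> = sqrt B * X" using L by (simp add: X_def real_sqrt_mult)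
    also have "(\<Sum>k<K. w k * (real (Suc k) / real N) * z k) = 1 / real N * (\<Sum>k<K. q ^ Suc k * z k)"
      unfolding w_def sum_distrib_left by (intro sum.cong refl) (simp del: of_nat_Suc power_Suc)
    finally show ?thesis .
  qed
  have "\<bar>real (card {i \<in> {1..N}. x i \<le> t}) - real N * t\<bar> \<le> 4 * (sqrt (8 * B) * X) + 6 + 12 * (sqrt B * X)"
    by (rule counting_error_le[OF _ x t]) (use N W1 W2 in \<open>auto simp: w_def z_def q_def\<close>)
  also have "\<dots> \<le> 4 * (sqrt (8 * B) * X) + 6 * X + 12 * (sqrt B * X)"
  proof -
    have "1 * 1 \<le> X" unfolding X_def using L N by (intro mult_mono) auto
    then show ?thesis by simp
  qed
  also have "\<dots> = (4 * sqrt (8 * B) + 6 + 12 * sqrt B) * X" by (simp add: algebra_simps)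
  also have "X = real N * (L / sqrt (real N))"
    unfolding X_def using N by (simp add: field_simps flip: mult.assoc)
  finally show "\<bar>real (card {i \<in> {1..N}. x i \<le> t}) - real N * t\<bar>
      \<le> real N * ((4 * sqrt (8 * B) + 6 + 12 * sqrt B) * (ln (real N) / sqrt (real N)))"
    by (simp add: L_def mult_ac)
qed (use N in simp)

theorem theorem2:
  fixes x :: "nat \<Rightarrow> real"
  assumes "\<And>n. n \<ge> 1 \<Longrightarrow> x n \<in> {0..1}"
    and "\<And>N. N \<ge> 2 \<Longrightarrow>
      (\<Sum>n = 1..N - 1. \<Sum>k = 1..N. cos (2 * pi * real k * (x N - x n)) / real k) \<le> 0"
  shows "\<exists>C>0. \<forall>N\<ge>2. star_discrepancy x N \<le> C * (ln (real N) / sqrt (real N))"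
proof -
  obtain B N0 where B: "0 < B" "2 \<le> N0" and E: "\<And>N M. N0 \<le> N \<Longrightarrow>
      (\<Sum>k<M. (1 - 1 / real N) ^ Suc k / real (Suc k) * (cmod (weyl x N (Suc k)))\<^sup>2)
        \<le> B * (real N * ln (real N))"
    using greedy_weyl_energy_bound[of x, OF assms(2)] by blast
  define C1 where "C1 = 4 * sqrt (8 * B) + 6 + 12 * sqrt B"
  \<comment> \<open>Below N0 + 3 the trivial bound 1 suffices, and C2 is chosen so that C2 ln 2 /
    sqrt (N0 + 3) = 1. The added 3 provides N \<ge> 3 in the other case.\<close>
  define C2 where "C2 = sqrt (real (N0 + 3)) / ln 2"
  have C: "0 < C1" "0 < C2" using B by (auto simp: C1_def C2_def add_pos_pos)
  have "star_discrepancy x N \<le> (C1 + C2) * (ln (real N) / sqrt (real N))" if N: "2 \<le> N" for N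
  proof (cases "N0 + 3 \<le> N")
    case True
    have "star_discrepancy x N \<le> C1 * (ln (real N) / sqrt (real N))"
      unfolding C1_def by (rule star_discrepancy_le_energy) (use True assms(1) B E in auto)
    also have "\<dots> \<le> (C1 + C2) * (ln (real N) / sqrt (real N))"
      using C N by (intro mult_right_mono) auto
    finally show ?thesis .
  next
    case False
    have "star_discrepancy x N \<le> 1" using N by (intro star_discrepancy_le_1) simp
    also have "1 = C2 * (ln 2 / sqrt (real (N0 + 3)))" by (simp add: C2_def)
    also have "\<dots> \<le> C2 * (ln (real N) / sqrt (real N))"
      using C False N by (intro mult_left_mono frac_le) auto
    also have "\<dots> \<le> (C1 + C2) * (ln (real N) / sqrt (real N))"
      using C N by (intro mult_right_mono) auto
    finally show ?thesis .
  qed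
  then show ?thesis using C by (intro exI[of _ "C1 + C2"]) auto
qed

end
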